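(* Let $N\ge 1$, let $E=\{x_i: i=0,1,\dots,N\}\subset\mathbb{R}$ with $x_0<x_1<\cdots<x_N$, and let $f:E\to\mathbb{R}$ satisfy $f(x_0)\le f(x_1)\le\cdots\le f(x_N)$. Define the monotone $C^{1,1}$ trace seminorm by $$\|f\|_{\dot C^{1,1}_{\mathrm{mon}}(E)}:=\inf\left\{\|F''\|_{L^\infty([x_0,x_N])} : F\in C^{1,1}([x_0,x_N]),\ F=f\text{ on }E,\ F'\ge 0\text{ on }[x_0,x_N]\right\}.$$ For each $i=0,1,\dots,N-1$ define $h_i:=x_{i+1}-x_i$ and $s_i:=\frac{f(x_{i+1})-f(x_i)}{h_i}$. For a slope vector $d=(d_0,d_1,\dots,d_N)\in\mathbb{R}^{N+1}_+$ (i.e. $d_i\ge 0$ for all $i$) define $$\mathcal{N}_{\mathrm{mon}}(f;d):=\max_{0\le i\le N-1}\frac{\mathcal{M}^*(d_i,d_{i+1},s_i)}{h_i}\quad\text{and}\quad \mathcal{N}_{\mathrm{mon}}(f):=\inf_{d\in\mathbb{R}^{N+1}_+}\mathcal{N}_{\mathrm{mon}}(f;d).$$ Then $$\|f\|_{\dot C^{1,1}_{\mathrm{mon}}(E)}=\mathcal{N}_{\mathrm{mon}}(f).$$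
   Context: For a compact interval $I$, $C^{1,1}(I)$ denotes the space of differentiable functions on $I$ with Lipschitz derivative (equivalently $W^{2,\infty}(I)$); $F''$ is understood in the sense of distributions. For real $a,b,c\ge 0$, $$\mathcal{M}^*(a,b,c):=\inf\left\{\|G''\|_{L^\infty([0,1])} : G\in C^{1,1}([0,1]),\ G(0)=0,\ G(1)=c,\ G'(0)=a,\ G'(1)=b,\ G'(x)\ge 0\ \forall x\in[0,1]\right\},$$ with the convention $\inf\varnothing=\infty$. Its explicit value is $\mathcal{M}^*(a,b,c)=\frac{a^2+b^2}{2c}$ if $0\le c\le c_0$ and $\mathcal{M}^*(a,b,c)=|2c-a-b|+\sqrt{(2c-a-b)^2+(b-a)^2}$ if $c\ge c_0$, where $c_0=\frac{a^2+b^2}{2(a+b)}$, with the convention $\frac00=0$ and $\frac{\varepsilon}{0}=\infty$ for $\varepsilon>0$. *)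

theory Defs
  imports "HOL-Analysis.Analysis" "HOL-Probability.Essential_Supremum"
begin

text \<open>
  A function on an interval \<open>I\<close> is a total function of type \<open>real \<Rightarrow> real\<close> whose values
  outside \<open>I\<close> play no role.  Its derivative is taken within \<open>I\<close>, hence is one-sided at the
  endpoints.
\<close>

abbreviation deriv_within :: "real set \<Rightarrow> (real \<Rightarrow> real) \<Rightarrow> real \<Rightarrow> real" where
  "deriv_within I F x \<equiv> vector_derivative F (at x within I)"

definition C11 :: "real set \<Rightarrow> (real \<Rightarrow> real) set" where
  "C11 I = {F. F differentiable_on I \<and> (\<exists>L. L-lipschitz_on I (deriv_within I F))}"

definition test_function :: "real set \<Rightarrow> (real \<Rightarrow> real) \<Rightarrow> bool" where
  "test_function U \<phi> \<longleftrightarrow>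
     (\<forall>n. (deriv ^^ n) \<phi> differentiable_on UNIV) \<and>
     compact (closure {x. \<phi> x \<noteq> 0}) \<and> closure {x. \<phi> x \<noteq> 0} \<subseteq> U"

definition locally_integrable :: "real set \<Rightarrow> (real \<Rightarrow> real) \<Rightarrow> bool" where
  "locally_integrable U g \<longleftrightarrow> (\<forall>K. compact K \<and> K \<subseteq> U \<longrightarrow> set_integrable lebesgue K g)"

text \<open>
  The second derivative of \<open>F\<close> in the sense of distributions on the interior of \<open>I\<close> is
  the functional sending \<open>\<phi>\<close> to the integral of \<open>F * \<phi>''\<close>; the following says that it is
  represented by the function \<open>g\<close>.
\<close>

definition distr_second_deriv :: "real set \<Rightarrow> (real \<Rightarrow> real) \<Rightarrow> (real \<Rightarrow> real) \<Rightarrow> bool" where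
  "distr_second_deriv I F g \<longleftrightarrow>
     locally_integrable (interior I) g \<and>
     (\<forall>\<phi>. test_function (interior I) \<phi> \<longrightarrow>
        (LINT x:interior I|lebesgue. F x * (deriv ^^ 2) \<phi> x) =
        (LINT x:interior I|lebesgue. g x * \<phi> x))"

definition Linf_norm :: "real set \<Rightarrow> (real \<Rightarrow> real) \<Rightarrow> ereal" where
  "Linf_norm I g = esssup (lebesgue_on I) (\<lambda>x. ereal \<bar>g x\<bar>)"

text \<open>
  The representative \<open>g\<close> of \<open>F''\<close> is unique up to null sets, so the infimum below merely
  selects the common value of its norm; it is \<open>\<infinity>\<close> if \<open>F''\<close> is not a function.
\<close>

definition norm_second_deriv :: "real set \<Rightarrow> (real \<Rightarrow> real) \<Rightarrow> ereal" where
  "norm_second_deriv I F = (INF g\<in>{g. distr_second_deriv I F g}. Linf_norm I g)"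

definition M_star :: "real \<Rightarrow> real \<Rightarrow> real \<Rightarrow> ereal" where
  "M_star a b c =
     (INF G\<in>{G \<in> C11 {0..1}. G 0 = 0 \<and> G 1 = c \<and>
               deriv_within {0..1} G 0 = a \<and> deriv_within {0..1} G 1 = b \<and>
               (\<forall>x\<in>{0..1}. deriv_within {0..1} G x \<ge> 0)}.
        norm_second_deriv {0..1} G)"

definition mon_trace_seminorm :: "real set \<Rightarrow> real set \<Rightarrow> (real \<Rightarrow> real) \<Rightarrow> ereal" where
  "mon_trace_seminorm I E f =
     (INF F\<in>{F \<in> C11 I. (\<forall>x\<in>E. F x = f x) \<and> (\<forall>x\<in>I. deriv_within I F x \<ge> 0)}.
        norm_second_deriv I F)"

definition gap :: "(nat \<Rightarrow> real) \<Rightarrow> nat \<Rightarrow> real" where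
  "gap x i = x (Suc i) - x i"

definition slope :: "(nat \<Rightarrow> real) \<Rightarrow> (real \<Rightarrow> real) \<Rightarrow> nat \<Rightarrow> real" where
  "slope x f i = (f (x (Suc i)) - f (x i)) / gap x i"

text \<open>
  A vector \<open>(d\<^sub>0, \<dots>, d\<^sub>N)\<close> is a function on \<open>nat\<close> of which only the values at \<open>i \<le> N\<close> are used.
\<close>

definition N_mon_at :: "nat \<Rightarrow> (nat \<Rightarrow> real) \<Rightarrow> (real \<Rightarrow> real) \<Rightarrow> (nat \<Rightarrow> real) \<Rightarrow> ereal" where
  "N_mon_at N x f d =
     Max ((\<lambda>i. M_star (d i) (d (Suc i)) (slope x f i) / ereal (gap x i)) ` {0..N - 1})"

definition N_mon :: "nat \<Rightarrow> (nat \<Rightarrow> real) \<Rightarrow> (real \<Rightarrow> real) \<Rightarrow> ereal" where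
  "N_mon N x f = (INF d\<in>{d. \<forall>i\<le>N. d i \<ge> 0}. N_mon_at N x f d)"

end

theory Submission
  imports Defs
begin

text \<open>
  Both sides are infima of bounds on second derivatives, so it suffices to transport a
  competitor with bound \<open>M\<close> from one problem to the other.  Restricting \<open>F\<close> to
  \<open>[x\<^sub>i, x\<^sub>i\<^sub>+\<^sub>1]\<close> and rescaling to \<open>[0, 1]\<close>, with \<open>d\<^sub>i = F' (x\<^sub>i)\<close>, gives one
  inequality.  For the other, rescaled competitors on the pieces are glued; values and slopes
  match at the nodes, and the only issue is that \<open>F''\<close> has no singular part there.  This
  follows once the distributional identity on a piece is known to imply integration by parts,
  with boundary terms, against smooth functions that need not vanish at the endpoints.
\<close>

section \<open>Smooth functions and cutoffs\<close>

text \<open>The obstacle is in the definition of F'' as a distribution: it tests only with functions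
  supported inside the open interval. A test function on the whole interval, cut to one piece, is in
  general not of that kind, and its values at the nodes are exactly what would detect a jump of F'.
  Each piece must therefore be tested with functions that are nonzero at its ends. Cutoffs make this
  possible, and the Lipschitz bound on F' pays for their blowing-up derivatives. The division by the
  gap comes from scaling. On a piece of length h with left end a, put G(t) = (F(a + h t) - F(a)) /
  h. Then G'(t) = F'(a + h t), so slopes and signs carry over, while G''(t) = h F''(a + h t). A
  bound M for F'' becomes the bound h M for G'', and one M has to serve on all pieces, whence the
  maximum. No infimum is assumed to be attained: a real M strictly above it yields a competitor, and
  the comparison is then read off from all such M.\<close>

definition smooth_fun :: "(real \<Rightarrow> real) \<Rightarrow> bool" where
  "smooth_fun \<phi> \<longleftrightarrow> (\<forall>n. (deriv ^^ n) \<phi> differentiable_on UNIV)"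

lemma smooth_fun_DERIV:
  assumes "smooth_fun \<phi>"
  shows "(\<phi> has_real_derivative deriv \<phi> x) (at x)"
proof -
  have "((deriv ^^ 0) \<phi>) differentiable_on UNIV"
    using assms unfolding smooth_fun_def by blast
  then show ?thesis
    by (simp add: differentiable_on_def DERIV_deriv_iff_real_differentiable)
qed

lemma smooth_fun_deriv:
  assumes "smooth_fun \<phi>"
  shows "smooth_fun (deriv \<phi>)"
  unfolding smooth_fun_def
proof
  fix n
  have "(deriv ^^ Suc n) \<phi> differentiable_on UNIV"
    using assms unfolding smooth_fun_def by blast
  then show "(deriv ^^ n) (deriv \<phi>) differentiable_on UNIV"
    by (simp add: funpow_swap1)
qed

lemma smooth_fun_continuous:
  assumes "smooth_fun \<phi>"
  shows "continuous_on A \<phi>"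
  using smooth_fun_DERIV[OF assms] DERIV_continuous_on has_field_derivative_at_within by blast

text \<open>Smoothness as a greatest fixed point: if a class is stable under differentiation, all
  iterated derivatives of a member stay in it. To prove a function smooth it is enough to guess such
  a class, and no formula for the n-th derivative is needed.\<close>

lemma smooth_fun_coinduct:
  assumes "X \<phi>"
    and step: "\<And>\<phi>. X \<phi> \<Longrightarrow> \<exists>\<psi>. (\<forall>x. (\<phi> has_real_derivative \<psi> x) (at x)) \<and> X \<psi>"
  shows "smooth_fun \<phi>"
proof -
  have X: "X ((deriv ^^ n) \<phi>)" for n
  proof (induction n)
    case (Suc n)
    then obtain \<psi> where "\<forall>x. ((deriv ^^ n) \<phi> has_real_derivative \<psi> x) (at x)" "X \<psi>"
      using step by blast
    moreover from this have "deriv ((deriv ^^ n) \<phi>) = \<psi>"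
      using DERIV_imp_deriv by blast
    ultimately show ?case by simp
  qed (use assms in simp)
  show ?thesis
    unfolding smooth_fun_def differentiable_on_def
    using step[OF X] DERIV_deriv_iff_real_differentiable by (metis DERIV_imp_deriv differentiable_at_withinI)
qed

lemma smooth_fun_antideriv:
  assumes "smooth_fun \<psi>" "\<And>x. (\<phi> has_real_derivative \<psi> x) (at x)"
  shows "smooth_fun \<phi>"
proof (rule smooth_fun_coinduct[where X = "\<lambda>f. f = \<phi> \<or> smooth_fun f"])
  fix f assume "f = \<phi> \<or> smooth_fun f"
  then show "\<exists>g. (\<forall>x. (f has_real_derivative g x) (at x)) \<and> (g = \<phi> \<or> smooth_fun g)"
  proof
    assume "f = \<phi>"
    then show ?thesis using assms by (intro exI[of _ \<psi>]) simp
  next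
    assume "smooth_fun f"
    then show ?thesis using smooth_fun_DERIV smooth_fun_deriv by (intro exI[of _ "deriv f"]) simp
  qed
qed simp

text \<open>Sums are included so that the class is stable under differentiation.\<close>

inductive sum_of_smooth_products :: "(real \<Rightarrow> real) \<Rightarrow> bool" where
  prod: "smooth_fun f \<Longrightarrow> smooth_fun g \<Longrightarrow> sum_of_smooth_products (\<lambda>x. f x * g x)"
| add: "sum_of_smooth_products f \<Longrightarrow> sum_of_smooth_products g \<Longrightarrow>
    sum_of_smooth_products (\<lambda>x. f x + g x)"

lemma smooth_fun_mult:
  assumes "smooth_fun f" "smooth_fun g"
  shows "smooth_fun (\<lambda>x. f x * g x)"
proof (rule smooth_fun_coinduct[where X = sum_of_smooth_products])
  show "sum_of_smooth_products (\<lambda>x. f x * g x)"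
    using assms by (rule sum_of_smooth_products.prod)
  fix h assume "sum_of_smooth_products h"
  then show "\<exists>h'. (\<forall>x. (h has_real_derivative h' x) (at x)) \<and> sum_of_smooth_products h'"
  proof induction
    case (prod f g)
    have "((\<lambda>x. f x * g x) has_real_derivative f x * deriv g x + deriv f x * g x) (at x)" for x
      using DERIV_mult'[OF smooth_fun_DERIV[OF prod(1)] smooth_fun_DERIV[OF prod(2)]] .
    moreover have "sum_of_smooth_products (\<lambda>x. f x * deriv g x + deriv f x * g x)"
      by (intro sum_of_smooth_products.intros smooth_fun_deriv prod)
    ultimately show ?case
      by (intro exI[of _ "\<lambda>x. f x * deriv g x + deriv f x * g x"]) simp
  next
    case (add f g)
    obtain f' where f': "\<forall>x. (f has_real_derivative f' x) (at x)" "sum_of_smooth_products f'"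
      using add.IH(1) by (elim exE conjE)
    obtain g' where g': "\<forall>x. (g has_real_derivative g' x) (at x)" "sum_of_smooth_products g'"
      using add.IH(2) by (elim exE conjE)
    show ?case
      using DERIV_add[OF f'(1)[rule_format] g'(1)[rule_format]] sum_of_smooth_products.add[OF f'(2) g'(2)]
      by (intro exI[of _ "\<lambda>x. f' x + g' x"]) simp
  qed
qed

lemma smooth_fun_affine:
  assumes "smooth_fun f"
  shows "smooth_fun (\<lambda>x. f (m * x + c))"
proof -
  \<comment> \<open>The scalar \<open>a\<close> makes the class stable: each differentiation brings
    out a factor \<open>m\<close>.\<close>
  have "\<exists>g a. smooth_fun g \<and> (\<lambda>x. f (m * x + c)) = (\<lambda>x. a * g (m * x + c))"
    by (rule exI[of _ f], rule exI[of _ 1]) (use assms in simp)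
  then show ?thesis
  proof (rule smooth_fun_coinduct[where X = "\<lambda>\<phi>. \<exists>g a. smooth_fun g \<and> \<phi> = (\<lambda>x. a * g (m * x + c))"])
    fix \<phi> assume "\<exists>g a. smooth_fun g \<and> \<phi> = (\<lambda>x. a * g (m * x + c))"
    then obtain g a where g: "smooth_fun g" "\<phi> = (\<lambda>x. a * g (m * x + c))"
      by (elim exE conjE)
    have "(\<phi> has_real_derivative (a * m) * deriv g (m * x + c)) (at x)" for x
    proof -
      have "((\<lambda>x. m * x + c) has_real_derivative m) (at x)"
        by (auto intro!: derivative_eq_intros)
      from DERIV_cmult[OF DERIV_chain2[OF smooth_fun_DERIV[OF g(1)] this], of a]
      show ?thesis unfolding g by (simp add: mult_ac)
    qed
    then show "\<exists>\<psi>. (\<forall>x. (\<phi> has_real_derivative \<psi> x) (at x)) \<and>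
        (\<exists>g a. smooth_fun g \<and> \<psi> = (\<lambda>x. a * g (m * x + c)))"
      by (intro exI[of _ "\<lambda>x. (a * m) * deriv g (m * x + c)"] exI[of _ "deriv g"] exI[of _ "a * m"] conjI allI)
        (auto simp: smooth_fun_deriv g(1))
  qed
qed

section \<open>The flat function exp(-1/x) and a smooth step\<close>

lemma poly_mult_exp_tendsto_0:
  fixes p :: "real poly"
  shows "((\<lambda>x. poly p x * exp (- x)) \<longlongrightarrow> 0) at_top"
proof -
  have "((\<lambda>x. \<Sum>i\<le>degree p. coeff p i * (x ^ i / exp x)) \<longlongrightarrow> (\<Sum>i\<le>degree p. coeff p i * 0)) at_top"
    by (intro tendsto_intros tendsto_power_div_exp_0)
  then show ?thesis
    by (simp add: poly_altdef exp_minus sum_distrib_right divide_inverse mult.assoc)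
qed

text \<open>For x > 0 every derivative has the form p(1/x) exp(-1/x) with a polynomial p, and one
  differentiation replaces p by X^2 (p - p'). All these functions, extended by 0, have derivative 0
  at the origin because the exponential beats polynomials, so they form a class stable under
  differentiation.\<close>

lemma smooth_fun_exp_inverse:
  "smooth_fun (\<lambda>x. if x \<le> 0 then 0 else exp (- (1 / x)))"
proof -
  define E :: "real poly \<Rightarrow> real \<Rightarrow> real"
    where "E p x = (if x \<le> 0 then 0 else poly p (1 / x) * exp (- (1 / x)))" for p x
  have at0: "(E p has_real_derivative 0) (at 0)" for p
  proof -
    have "((\<lambda>x. E p x / x) \<longlongrightarrow> 0) (at_right 0)"
    proof -
      \<comment> \<open>The extra factor X of the polynomial is the 1/x of the difference quotient
        at 0.\<close>
      have "((\<lambda>x. poly (p * [:0, 1:]) (1 / x) * exp (- (1 / x))) \<longlongrightarrow> 0) (at_right 0)"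
        using filterlim_compose[OF poly_mult_exp_tendsto_0[of "p * [:0, 1:]"] filterlim_inverse_at_top_right]
        by (simp add: divide_inverse)
      then show ?thesis
        by (rule Lim_transform_eventually) (auto simp: eventually_at_filter E_def)
    qed
    moreover have "((\<lambda>x. E p x / x) \<longlongrightarrow> 0) (at_left 0)"
      by (rule Lim_transform_eventually[of "\<lambda>_. 0"]) (auto simp: eventually_at_filter E_def)
    ultimately have "((\<lambda>x. E p x / x) \<longlongrightarrow> 0) (at 0)"
      by (simp add: filterlim_at_split)
    then show ?thesis
      by (simp add: has_field_derivative_iff E_def)
  qed
  have deriv: "(E p has_real_derivative E (monom 1 2 * (p - pderiv p)) x) (at x)" for p x
  proof (cases x "0 :: real" rule: linorder_cases)
    case less
    have "((\<lambda>_. 0) has_real_derivative 0) (at x)" by simp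
    then have "(E p has_real_derivative 0) (at x)"
      by (rule has_field_derivative_transform_within_open[of _ _ _ "{..<0}"])
        (use less in \<open>auto simp: E_def\<close>)
    then show ?thesis using less by (simp add: E_def)
  next
    case equal
    then show ?thesis using at0[of p] by (simp add: E_def)
  next
    case greater
    have "((\<lambda>x. poly p (1 / x) * exp (- (1 / x))) has_real_derivative
       poly (monom 1 2 * (p - pderiv p)) (1 / x) * exp (- (1 / x))) (at x)"
    proof -
      have inv: "((\<lambda>x. 1 / x) has_real_derivative - (1 / x\<^sup>2)) (at x)"
        using greater by (auto intro!: derivative_eq_intros simp: power2_eq_square)
      have "((\<lambda>x. exp (- (1 / x))) has_real_derivative exp (- (1 / x)) * (1 / x\<^sup>2)) (at x)"
        using DERIV_chain2[OF DERIV_exp DERIV_minus[OF inv]] by simp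
      from DERIV_mult'[OF DERIV_chain2[OF poly_DERIV inv] this]
      show ?thesis
        by (rule DERIV_cong) (simp add: poly_monom power_one_over algebra_simps)
    qed
    then have "(E p has_real_derivative poly (monom 1 2 * (p - pderiv p)) (1 / x) * exp (- (1 / x))) (at x)"
      by (rule has_field_derivative_transform_within_open[of _ _ _ "{0<..}"])
        (use greater in \<open>auto simp: E_def\<close>)
    then show ?thesis using greater by (simp add: E_def)
  qed
  have "smooth_fun (E 1)"
  proof (rule smooth_fun_coinduct[where X = "\<lambda>f. \<exists>p. f = E p"])
    fix f assume "\<exists>p. f = E p"
    then obtain p where "f = E p" ..
    then show "\<exists>g. (\<forall>x. (f has_real_derivative g x) (at x)) \<and> (\<exists>p. g = E p)"
      using deriv[of p] by (intro exI[of _ "E (monom 1 2 * (p - pderiv p))"]) auto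
  qed blast
  moreover have "E 1 = (\<lambda>x. if x \<le> 0 then 0 else exp (- (1 / x)))"
    by (auto simp: E_def)
  ultimately show ?thesis by simp
qed

text \<open>The step is a normalised primitive of the bump \<open>B\<close>, which is positive
  exactly on (1, 2). As \<open>B\<close> is at most 1, the constant \<open>C\<close> is
  \<open>1 / (F 2 - F 1)\<close>. The last two conclusions together bound u S'(u) for u \<ge> 0, the
  scale-invariant quantity behind the cutoff estimate.\<close>

lemma smooth_step_exists:
  obtains S C where "smooth_fun S" "\<And>x. 0 \<le> S x" "\<And>x. S x \<le> 1"
    "\<And>x. x \<le> 1 \<Longrightarrow> S x = 0" "\<And>x. x \<ge> 2 \<Longrightarrow> S x = 1"
    "\<And>x. \<bar>deriv S x\<bar> \<le> C" "\<And>x. x \<ge> 2 \<Longrightarrow> deriv S x = 0"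
proof -
  define E :: "real \<Rightarrow> real" where "E x = (if x \<le> 0 then 0 else exp (- (1 / x)))" for x
  define B where "B x = E (x - 1) * E (2 - x)" for x
  have E: "smooth_fun E" "\<And>x. 0 \<le> E x" "\<And>x. E x \<le> 1" "\<And>x. x > 0 \<Longrightarrow> 0 < E x" "\<And>x. x \<le> 0 \<Longrightarrow> E x = 0"
    using smooth_fun_exp_inverse unfolding E_def[abs_def] by auto
  have sB: "smooth_fun B"
    using smooth_fun_mult[OF smooth_fun_affine[OF E(1), of 1 "-1"] smooth_fun_affine[OF E(1), of "-1" 2]]
    by (simp add: B_def[abs_def])
  have B: "\<And>x. 0 \<le> B x" "\<And>x. B x \<le> 1" "\<And>x. x \<le> 1 \<Longrightarrow> B x = 0" "\<And>x. x \<ge> 2 \<Longrightarrow> B x = 0"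
    "\<And>x. 1 < x \<Longrightarrow> x < 2 \<Longrightarrow> 0 < B x"
    using E by (auto simp: B_def mult_le_one)
  obtain F where F: "\<And>x. (F has_vector_derivative B x) (at x)"
    using einterval_antiderivative[of "-\<infinity>" "\<infinity>" B] smooth_fun_continuous[OF sB, of UNIV]
    by (fastforce simp: continuous_on_eq_continuous_at)
  then have F: "(F has_real_derivative B x) (at x)" for x
    by (simp add: has_real_derivative_iff_has_vector_derivative)
  have mono: "F x \<le> F y" if "x \<le> y" for x y
    using DERIV_nonneg_imp_nondecreasing[OF that] F B(1) by blast
  have const1: "F x = F 1" if "x \<le> 1" for x
    using DERIV_nonpos_imp_nonincreasing[OF that, of F] F B(3) mono[OF that]
    by (metis order.antisym order.refl)
  have const2: "F x = F 2" if "x \<ge> 2" for x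
    using DERIV_nonpos_imp_nonincreasing[OF that, of F] F B(4) mono[OF that]
    by (metis order.antisym order.refl)
  have "F 1 < F 2"
    by (rule DERIV_pos_imp_increasing_open[of 1 2 F])
      (use F B(5) in \<open>auto intro: DERIV_continuous_on has_field_derivative_at_within\<close>)
  define S where "S x = (F x - F 1) / (F 2 - F 1)" for x
  have D: "(S has_real_derivative B x / (F 2 - F 1)) (at x)" for x
    unfolding S_def using \<open>F 1 < F 2\<close> by (auto intro!: derivative_eq_intros F)
  then have dS: "deriv S x = B x / (F 2 - F 1)" for x
    by (rule DERIV_imp_deriv)
  have "smooth_fun (\<lambda>x. 1 / (F 2 - F 1))"
    by (rule smooth_fun_coinduct[where X = "\<lambda>f. \<exists>c. f = (\<lambda>_. c)"]) (auto intro: exI[of _ "\<lambda>_. 0"])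
  then have "smooth_fun (\<lambda>x. B x / (F 2 - F 1))"
    using smooth_fun_mult[OF sB, of "\<lambda>x. 1 / (F 2 - F 1)"] by simp
  from smooth_fun_antideriv[OF this D] have "smooth_fun S" .
  moreover have "0 \<le> S x" "S x \<le> 1" for x
    using mono[of x 1] mono[of 1 x] mono[of x 2] const1[of x] const2[of x] \<open>F 1 < F 2\<close>
    unfolding S_def by (simp_all add: field_simps, linarith+)
  moreover have "S x = 0" if "x \<le> 1" for x
    using const1[OF that] by (simp add: S_def)
  moreover have "S x = 1" if "x \<ge> 2" for x
    using const2[OF that] \<open>F 1 < F 2\<close> by (simp add: S_def)
  moreover have "\<bar>deriv S x\<bar> \<le> 1 / (F 2 - F 1)" for x
    using B(1,2)[of x] \<open>F 1 < F 2\<close> by (simp add: dS divide_right_mono)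
  moreover have "deriv S x = 0" if "x \<ge> 2" for x
    using B(4)[OF that] by (simp add: dS)
  ultimately show ?thesis
    by (rule that)
qed

section \<open>Weak second derivatives\<close>

lemma test_function_smooth: "test_function U \<phi> \<Longrightarrow> smooth_fun \<phi>"
  by (simp add: test_function_def smooth_fun_def)

lemma test_functionI:
  assumes "smooth_fun \<phi>" "compact K" "\<And>x. x \<notin> K \<Longrightarrow> \<phi> x = 0" "K \<subseteq> U"
  shows "test_function U \<phi>"
proof -
  have sub: "closure {x. \<phi> x \<noteq> 0} \<subseteq> K"
    using assms(2,3) by (intro closure_minimal) (auto simp: compact_imp_closed)
  have "compact (closure {x. \<phi> x \<noteq> 0})"
    using bounded_subset[OF compact_imp_bounded[OF assms(2)] sub] by (simp add: compact_eq_bounded_closed)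
  then show ?thesis
    using assms(1,4) sub by (auto simp: test_function_def smooth_fun_def)
qed

lemma test_function_deriv:
  assumes "test_function U \<phi>"
  shows "test_function U (deriv \<phi>)"
proof -
  have "deriv \<phi> x = 0" if "x \<notin> closure {x. \<phi> x \<noteq> 0}" for x
  proof -
    have "((\<lambda>_. 0) has_real_derivative 0) (at x)" by simp
    then have "(\<phi> has_real_derivative 0) (at x)"
      by (rule has_field_derivative_transform_within_open[where S = "- closure {x. \<phi> x \<noteq> 0}"])
        (use that closure_subset[of "{x. \<phi> x \<noteq> 0}"] in auto)
    then show ?thesis by (rule DERIV_imp_deriv)
  qed
  then show ?thesis
    using smooth_fun_deriv[OF test_function_smooth[OF assms]] assms
    by (intro test_functionI[where K = "closure {x. \<phi> x \<noteq> 0}"]) (auto simp: test_function_def)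
qed

lemma test_function_eq_0:
  assumes "test_function U \<phi>" "x \<notin> U"
  shows "\<phi> x = 0"
  using assms closure_subset[of "{x. \<phi> x \<noteq> 0}"] by (auto simp: test_function_def)

lemma test_function_mono: "test_function U \<phi> \<Longrightarrow> U \<subseteq> V \<Longrightarrow> test_function V \<phi>"
  by (auto simp: test_function_def)

lemma absolutely_integrable_bounded_times_continuous:
  fixes g h :: "real \<Rightarrow> real"
  assumes "g \<in> borel_measurable borel" "\<And>x. \<bar>g x\<bar> \<le> M" "continuous_on {p..q} h"
  shows "(\<lambda>x. g x * h x) absolutely_integrable_on {p..q}"
proof (rule absolutely_integrable_bounded_measurable_product_real)
  show "g \<in> borel_measurable (lebesgue_on {p..q})"
    using assms(1) by (intro measurable_restrict_space1 measurable_completion) simp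
  show "bounded (g ` {p..q})"
    using assms(2) by (auto simp: bounded_iff)
qed (use assms absolutely_integrable_continuous_real in auto)

text \<open>
  A second derivative in the sense of distributions, with a representative normalised to be
  Borel and bounded everywhere, and with Henstock--Kurzweil integrals.
\<close>

definition weak_second_deriv ::
    "real \<Rightarrow> real \<Rightarrow> real \<Rightarrow> (real \<Rightarrow> real) \<Rightarrow> (real \<Rightarrow> real) \<Rightarrow> bool" where
  "weak_second_deriv p q M F g \<longleftrightarrow> g \<in> borel_measurable borel \<and> (\<forall>x. \<bar>g x\<bar> \<le> M) \<and>
    (\<forall>\<phi>. test_function {p<..<q} \<phi> \<longrightarrow>
      integral {p..q} (\<lambda>x. F x * deriv (deriv \<phi>) x) = integral {p..q} (\<lambda>x. g x * \<phi> x))"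

lemma LINT_Ioo_eq_integral:
  fixes f :: "real \<Rightarrow> real"
  assumes "f absolutely_integrable_on {p..q}"
  shows "(LINT x:{p<..<q}|lebesgue. f x) = integral {p..q} f"
proof -
  have "f absolutely_integrable_on {p<..<q}"
    by (rule set_integrable_subset[OF assms]) auto
  from set_lebesgue_integral_eq_integral(2)[OF this] show ?thesis
    by (simp add: integral_open_interval_real)
qed

lemma LINT_Ioo_times_second_deriv:
  assumes "continuous_on {p..q} F" "smooth_fun \<phi>"
  shows "(LINT x:{p<..<q}|lebesgue. F x * (deriv ^^ 2) \<phi> x) =
    integral {p..q} (\<lambda>x. F x * deriv (deriv \<phi>) x)"
  using LINT_Ioo_eq_integral[OF absolutely_integrable_continuous_real[OF continuous_on_mult[OF assms(1)
    smooth_fun_continuous[OF smooth_fun_deriv[OF smooth_fun_deriv[OF assms(2)]]]]]]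
  by (simp add: numeral_2_eq_2)

lemma norm_second_deriv_le:
  assumes F: "continuous_on {p..q} F" and w: "weak_second_deriv p q M F g"
  shows "norm_second_deriv {p..q} F \<le> ereal M"
proof -
  have g: "g \<in> borel_measurable borel" "\<And>x. \<bar>g x\<bar> \<le> M"
    using w by (auto simp: weak_second_deriv_def)
  have "distr_second_deriv {p..q} F g"
    unfolding distr_second_deriv_def locally_integrable_def interior_atLeastAtMost_real
  proof (intro conjI allI impI)
    fix K :: "real set" assume K: "compact K \<and> K \<subseteq> {p<..<q}"
    have "(\<lambda>x. g x * 1) absolutely_integrable_on {p..q}"
      using g by (rule absolutely_integrable_bounded_times_continuous) simp
    then show "g absolutely_integrable_on K"
      using set_integrable_subset[of lebesgue "{p..q}" g K] K
      by (fastforce simp: compact_imp_closed borel_closed)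
  next
    fix \<phi> assume \<phi>: "test_function {p<..<q} \<phi>"
    then have s: "smooth_fun \<phi>" by (rule test_function_smooth)
    show "(LINT x:{p<..<q}|lebesgue. F x * (deriv ^^ 2) \<phi> x) = (LINT x:{p<..<q}|lebesgue. g x * \<phi> x)"
      using \<phi> w LINT_Ioo_eq_integral[OF absolutely_integrable_bounded_times_continuous[OF g smooth_fun_continuous[OF s]]]
      by (simp add: LINT_Ioo_times_second_deriv[OF F s] weak_second_deriv_def)
  qed
  moreover have "Linf_norm {p..q} g \<le> ereal M"
    unfolding Linf_norm_def
  proof (rule esssup_I)
    show "(\<lambda>x. ereal \<bar>g x\<bar>) \<in> borel_measurable (lebesgue_on {p..q})"
      using g(1) by (intro measurable_restrict_space1 measurable_completion) simp
  qed (use g in simp)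
  ultimately show ?thesis
    unfolding norm_second_deriv_def by (intro INF_lower2) auto
qed

text \<open>Strict inequality selects a representative from the infimum. It is bounded only almost
  everywhere and Lebesgue measurable; it is replaced by a Borel function with a bound valid
  everywhere, which changes no integral over (p, q).\<close>

lemma norm_second_deriv_lessE:
  assumes F: "continuous_on {p..q} F" and "p < q" and less: "norm_second_deriv {p..q} F < ereal M"
  obtains g where "weak_second_deriv p q M F g"
proof -
  obtain g where g: "distr_second_deriv {p..q} F g" and gM: "Linf_norm {p..q} g < ereal M"
    using less by (auto simp: norm_second_deriv_def INF_less_iff)
  have "AE x in lebesgue_on {p..q}. \<bar>g x\<bar> \<le> M"
  proof -
    have "AE x in lebesgue_on {p..q}. ereal \<bar>g x\<bar> \<le> Linf_norm {p..q} g"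
      unfolding Linf_norm_def by (rule esssup_AE)
    then show ?thesis
      by (rule eventually_mono) (metis gM ereal_less_eq(3) order.trans less_imp_le)
  qed
  then have AE_M: "AE x in lebesgue. x \<in> {p..q} \<longrightarrow> \<bar>g x\<bar> \<le> M"
    by (simp add: AE_restrict_space_iff)
  \<comment> \<open>Otherwise the a.e. bound could hold only if [p, q] were null. The sign is needed
    so that the value 0 respects the bound when \<open>g2\<close> is defined.\<close>
  have "0 \<le> M"
  proof (rule ccontr)
    assume "\<not> 0 \<le> M"
    with AE_M have "AE x in lebesgue. x \<notin> {p..q}"
      by (auto elim!: eventually_mono)
    then have "{p..q} \<in> null_sets lebesgue"
      by (subst (asm) AE_iff_null_sets[symmetric]) auto
    then show False
      using \<open>p < q\<close> by (simp add: null_sets_def)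
  qed
  define g0 where "g0 x = indicator {p<..<q} x * g x" for x
  have "g0 \<in> borel_measurable lebesgue"
  \<comment> \<open>Local integrability gives measurability on compact subintervals of (p, q). These
    exhaust (p, q), and \<open>g0\<close> is the pointwise limit of the corresponding truncations of
    \<open>g\<close>.\<close>
  proof (rule borel_measurable_LIMSEQ_real)
    define e where "e n = 1 / real (Suc n)" for n
    have pos: "0 < e n" for n
      by (simp add: e_def)
    have lim: "e \<longlonglongrightarrow> 0"
      unfolding e_def[abs_def] by (rule LIMSEQ_Suc[OF lim_1_over_n])
    let ?K = "\<lambda>n. {p + e n .. q - e n}"
    show "(\<lambda>x. indicator (?K n) x *\<^sub>R g x) \<in> borel_measurable lebesgue" for n
    proof -
      have "?K n \<subseteq> {p<..<q}"
        using pos[of n] by auto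
      then have "set_integrable lebesgue (?K n) g"
        using g by (simp add: distr_second_deriv_def locally_integrable_def)
      then show ?thesis
        unfolding set_integrable_def by (rule borel_measurable_integrable)
    qed
    fix x
    show "(\<lambda>n. indicator (?K n) x *\<^sub>R g x) \<longlonglongrightarrow> g0 x"
    proof (cases "x \<in> {p<..<q}")
      case True
      have "\<forall>\<^sub>F n in sequentially. e n < min (x - p) (q - x)"
        by (rule order_tendstoD[OF lim]) (use True in auto)
      then have "\<forall>\<^sub>F n in sequentially. g x = indicator (?K n) x *\<^sub>R g x"
        by (rule eventually_mono) (simp add: indicator_def)
      then have "\<forall>\<^sub>F n in sequentially. indicator (?K n) x *\<^sub>R g x = g0 x"
        by (rule eventually_mono) (use True in \<open>simp add: g0_def\<close>)
      then show ?thesis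
        by (rule tendsto_eventually)
    next
      case False
      have "x \<notin> ?K n" for n
        using False pos[of n] by auto
      then show ?thesis using False by (simp add: g0_def)
    qed
  qed
  then obtain g1 where g1: "g1 \<in> borel_measurable lborel" "AE x in lborel. g0 x = g1 x"
    using completion_ex_borel_measurable_real by blast
  \<comment> \<open>Only on a null set does \<open>g1\<close> violate the bound, so resetting it to
    0 there is harmless and turns the a.e. bound into a pointwise one.\<close>
  define g2 where "g2 x = (if \<bar>g1 x\<bar> \<le> M then g1 x else 0)" for x
  have g2: "g2 \<in> borel_measurable borel"
    using g1(1) unfolding g2_def[abs_def] by simp
  have g2M: "\<bar>g2 x\<bar> \<le> M" for x
    using \<open>0 \<le> M\<close> by (simp add: g2_def)
  have AE_eq: "AE x \<in> {p<..<q} in lebesgue. g0 x = g2 x"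
    using AE_completion[OF g1(2)] AE_M
    by eventually_elim (auto simp: g2_def g0_def)
  have "weak_second_deriv p q M F g2"
    unfolding weak_second_deriv_def
  proof (intro conjI allI impI g2 g2M)
    fix \<phi> assume \<phi>: "test_function {p<..<q} \<phi>"
    then have s: "smooth_fun \<phi>" by (rule test_function_smooth)
    then have [measurable]: "\<phi> \<in> borel_measurable borel"
      by (intro borel_measurable_continuous_onI smooth_fun_continuous)
    have "integral {p..q} (\<lambda>x. F x * deriv (deriv \<phi>) x) = (LINT x:{p<..<q}|lebesgue. g x * \<phi> x)"
      unfolding LINT_Ioo_times_second_deriv[OF F s, symmetric]
      using g \<phi> by (simp add: distr_second_deriv_def)
    also have "\<dots> = (LINT x:{p<..<q}|lebesgue. g0 x * \<phi> x)"
      by (rule set_lebesgue_integral_cong) (auto simp: g0_def)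
    also have "\<dots> = (LINT x:{p<..<q}|lebesgue. g2 x * \<phi> x)"
    proof (rule set_lebesgue_integral_cong_AE)
      have "\<phi> \<in> borel_measurable lebesgue" "g2 \<in> borel_measurable lebesgue"
        using g2 by (auto intro!: measurable_completion)
      then show "(\<lambda>x. g0 x * \<phi> x) \<in> borel_measurable lebesgue" "(\<lambda>x. g2 x * \<phi> x) \<in> borel_measurable lebesgue"
        using \<open>g0 \<in> borel_measurable lebesgue\<close> by simp_all
    qed (use AE_eq in \<open>simp_all add: eventually_mono\<close>)
    also have "\<dots> = integral {p..q} (\<lambda>x. g2 x * \<phi> x)"
      by (rule LINT_Ioo_eq_integral[OF absolutely_integrable_bounded_times_continuous[OF g2 g2M smooth_fun_continuous[OF s]]])
    finally show "integral {p..q} (\<lambda>x. F x * deriv (deriv \<phi>) x) = integral {p..q} (\<lambda>x. g2 x * \<phi> x)" .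
  qed
  then show ?thesis by (rule that)
qed

text \<open>Dominated convergence with majorant \<open>\<bar>f x\<bar>\<close>. It is carried out on
  the open interval because the cutoffs to which it is applied vanish at the endpoints and converge
  to 1 only inside.\<close>

lemma integral_times_cutoff_tendsto:
  fixes f :: "real \<Rightarrow> real"
  assumes f: "f absolutely_integrable_on {p..q}"
    and \<kappa>: "\<And>n. continuous_on {p..q} (\<kappa> n)" "\<And>n x. \<bar>\<kappa> n x\<bar> \<le> 1"
    and lim: "\<And>x. x \<in> {p<..<q} \<Longrightarrow> (\<lambda>n. \<kappa> n x) \<longlonglongrightarrow> 1"
  shows "(\<lambda>n. integral {p..q} (\<lambda>x. f x * \<kappa> n x)) \<longlonglongrightarrow> integral {p..q} f"
proof -
  have "(\<lambda>x. f x * \<kappa> n x) absolutely_integrable_on {p<..<q}" for n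
  proof -
    have "(\<lambda>x. \<kappa> n x * f x) absolutely_integrable_on {p..q}"
      using \<kappa> f by (intro absolutely_integrable_bounded_measurable_product_real)
        (auto simp: bounded_iff intro!: continuous_imp_measurable_on_sets_lebesgue)
    then show ?thesis
      by (auto intro: set_integrable_subset simp: mult.commute)
  qed
  then have int: "(\<lambda>x. f x * \<kappa> n x) integrable_on {p<..<q}" for n
    by (rule set_lebesgue_integral_eq_integral(1))
  have abs: "(\<lambda>x. \<bar>f x\<bar>) integrable_on {p<..<q}"
    using f by (simp add: absolutely_integrable_on_def integrable_on_open_interval_real)
  have "(\<lambda>n. integral {p<..<q} (\<lambda>x. f x * \<kappa> n x)) \<longlonglongrightarrow> integral {p<..<q} f"
  proof (rule dominated_convergence(2)[OF int abs])
    show "norm (f x * \<kappa> n x) \<le> \<bar>f x\<bar>" for n x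
      using \<kappa>(2)[of n x] by (simp add: abs_mult mult_left_le)
    show "(\<lambda>n. f x * \<kappa> n x) \<longlonglongrightarrow> f x" if "x \<in> {p<..<q}" for x
      using tendsto_mult_left[OF lim[OF that], of "f x"] by simp
  qed
  then show ?thesis
    by (simp add: integral_open_interval_real)
qed

text \<open>
  The last bound is what controls \<open>P * \<kappa>\<^sub>n'\<close> for a Lipschitz function \<open>P\<close> vanishing at
  the endpoints, although \<open>\<kappa>\<^sub>n'\<close> itself is unbounded in \<open>n\<close>.
\<close>

lemma smooth_cutoff_exists:
  fixes p q :: real
  assumes "p < q"
  obtains \<kappa> :: "nat \<Rightarrow> real \<Rightarrow> real" and C where
    "\<And>n. smooth_fun (\<kappa> n)" "\<And>n. test_function {p<..<q} (\<kappa> n)"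
    "\<And>n x. \<bar>\<kappa> n x\<bar> \<le> 1" "\<And>x. x \<in> {p<..<q} \<Longrightarrow> (\<lambda>n. \<kappa> n x) \<longlonglongrightarrow> 1"
    "\<And>x. x \<in> {p<..<q} \<Longrightarrow> (\<lambda>n. deriv (\<kappa> n) x) \<longlonglongrightarrow> 0"
    "\<And>n x. x \<in> {p..q} \<Longrightarrow> \<bar>deriv (\<kappa> n) x\<bar> * min (x - p) (q - x) \<le> C"
proof -
  obtain S K where S: "smooth_fun S" "\<And>x. 0 \<le> S x" "\<And>x. S x \<le> 1"
    and S0: "\<And>x. x \<le> 1 \<Longrightarrow> S x = 0" and S1: "\<And>x. x \<ge> 2 \<Longrightarrow> S x = 1"
    and K: "\<And>x. \<bar>deriv S x\<bar> \<le> K" and dS0: "\<And>x. x \<ge> 2 \<Longrightarrow> deriv S x = 0"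
    using smooth_step_exists by blast
  \<comment> \<open>One step at each end, shrunk by the factor n + 1: \<open>\<kappa> n\<close>
    vanishes within distance 1/(n+1) of either endpoint and is 1 at distance at least 2/(n+1) from
    both.\<close>
  define \<kappa> where "\<kappa> n x = S (Suc n * (x - p)) * S (Suc n * (q - x))" for n :: nat and x
  have smooth: "smooth_fun (\<kappa> n)" for n
    using smooth_fun_mult[OF smooth_fun_affine[OF S(1), of "Suc n" "- (Suc n * p)"]
        smooth_fun_affine[OF S(1), of "- Suc n" "Suc n * q"]]
    by (simp add: \<kappa>_def[abs_def] algebra_simps)
  have deriv: "deriv (\<kappa> n) x = Suc n * (S (Suc n * (q - x)) * deriv S (Suc n * (x - p))
      - S (Suc n * (x - p)) * deriv S (Suc n * (q - x)))" for n x
  proof -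
    have a: "((\<lambda>x. real (Suc n) * (x - p)) has_real_derivative real (Suc n)) (at x)"
      and b: "((\<lambda>x. real (Suc n) * (q - x)) has_real_derivative - real (Suc n)) (at x)"
      by (auto intro!: derivative_eq_intros)
    from DERIV_mult'[OF DERIV_chain2[OF smooth_fun_DERIV[OF S(1)] a]
        DERIV_chain2[OF smooth_fun_DERIV[OF S(1)] b]]
    show ?thesis
      unfolding \<kappa>_def[abs_def] by (intro DERIV_imp_deriv) (simp add: algebra_simps)
  qed
  have test: "test_function {p<..<q} (\<kappa> n)" for n
  proof (rule test_functionI[OF smooth compact_Icc])
    fix x assume "x \<notin> {p + 1 / real (Suc n)..q - 1 / real (Suc n)}"
    then have "x - p < 1 / real (Suc n) \<or> q - x < 1 / real (Suc n)"
      by auto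
    then have "real (Suc n) * (x - p) \<le> 1 \<or> real (Suc n) * (q - x) \<le> 1"
      by (auto simp: field_simps)
    then show "\<kappa> n x = 0"
      using S0 by (auto simp: \<kappa>_def)
  next
    have "{p + e..q - e} \<subseteq> {p<..<q}" if "0 < e" for e
      using that by auto
    then show "{p + 1 / real (Suc n)..q - 1 / real (Suc n)} \<subseteq> {p<..<q}"
      by simp
  qed
  have ev: "\<forall>\<^sub>F n in sequentially. 2 \<le> Suc n * (x - p) \<and> 2 \<le> Suc n * (q - x)" if "x \<in> {p<..<q}" for x
  proof -
    have "\<forall>\<^sub>F n in sequentially. 2 \<le> real (Suc n) * c" if "0 < c" for c :: real
    proof -
      have "\<forall>\<^sub>F n in sequentially. 2 / c \<le> real n"
        by (rule eventually_sequentiallyI[of "nat \<lceil>2 / c\<rceil>"]) linarith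
      then show ?thesis
        by (rule eventually_mono) (use that in \<open>simp add: field_simps\<close>)
    qed
    then show ?thesis
      using that by (intro eventually_conj) auto
  qed
  \<comment> \<open>With u = (n+1) c this bounds u S'(u), uniformly in n: S'(u) vanishes for u \<ge>
    2 and is at most \<open>K\<close> in absolute value before that. The factor n + 1 from the chain
    rule is thereby absorbed by the distance.\<close>
  have near: "\<bar>deriv S (real (Suc n) * c)\<bar> * (real (Suc n) * c) \<le> 2 * K" if "0 \<le> c" for n c
  proof (cases "real (Suc n) * c < 2")
    case True
    then show ?thesis
      using mult_mono[OF K[of "real (Suc n) * c"], of "real (Suc n) * c" 2] that K[of 0] by (simp add: mult.commute)
  next
    case False
    then show ?thesis using dS0[of "real (Suc n) * c"] K[of 0] by simp
  qed
  have bound: "\<bar>deriv (\<kappa> n) x\<bar> * min (x - p) (q - x) \<le> 4 * K" if x: "x \<in> {p..q}" for n x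
  proof -
    define m where "m = min (x - p) (q - x)"
    let ?a = "real (Suc n) * (x - p)" and ?b = "real (Suc n) * (q - x)"
    have m: "0 \<le> m" "m \<le> x - p" "m \<le> q - x" using x by (auto simp: m_def)
    \<comment> \<open>Each endpoint contributes one term, with its own distance at least
      \<open>m\<close>; hence twice the bound 2 K.\<close>
    have "\<bar>S ?b * deriv S ?a - S ?a * deriv S ?b\<bar> \<le> \<bar>deriv S ?a\<bar> + \<bar>deriv S ?b\<bar>"
    proof -
      have "\<bar>S ?b * deriv S ?a\<bar> \<le> \<bar>deriv S ?a\<bar>" "\<bar>S ?a * deriv S ?b\<bar> \<le> \<bar>deriv S ?b\<bar>"
        using S(2,3) by (simp_all add: abs_mult mult_left_le_one_le)
      then show ?thesis by linarith
    qed
    then have "\<bar>deriv (\<kappa> n) x\<bar> * m \<le> (real (Suc n) * (\<bar>deriv S ?a\<bar> + \<bar>deriv S ?b\<bar>)) * m"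
      unfolding deriv abs_mult using m by (intro mult_right_mono mult_mono) auto
    also have "\<dots> = \<bar>deriv S ?a\<bar> * (real (Suc n) * m) + \<bar>deriv S ?b\<bar> * (real (Suc n) * m)"
      by (simp add: algebra_simps)
    also have "\<dots> \<le> \<bar>deriv S ?a\<bar> * ?a + \<bar>deriv S ?b\<bar> * ?b"
      using m by (intro add_mono mult_left_mono) auto
    also have "\<dots> \<le> 2 * K + 2 * K"
      using x by (intro add_mono near) auto
    finally show ?thesis by (simp add: m_def)
  qed
  show ?thesis
  proof (rule that[of \<kappa> "4 * K"])
    show "\<bar>\<kappa> n x\<bar> \<le> 1" for n x
      using S(2,3) by (simp add: \<kappa>_def abs_mult mult_le_one)
    show "(\<lambda>n. \<kappa> n x) \<longlonglongrightarrow> 1" if "x \<in> {p<..<q}" for x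
      by (rule tendsto_eventually, rule eventually_mono[OF ev[OF that]]) (simp add: \<kappa>_def S1)
    show "(\<lambda>n. deriv (\<kappa> n) x) \<longlonglongrightarrow> 0" if "x \<in> {p<..<q}" for x
      by (rule tendsto_eventually, rule eventually_mono[OF ev[OF that]]) (simp add: deriv dS0)
  qed (fact smooth test bound)+
qed

lemma deriv_mult_smooth:
  assumes "smooth_fun f" "smooth_fun g"
  shows "deriv (\<lambda>x. f x * g x) x = f x * deriv g x + deriv f x * g x"
  by (rule DERIV_imp_deriv[OF DERIV_mult'[OF smooth_fun_DERIV[OF assms(1)] smooth_fun_DERIV[OF assms(2)]]])

lemma test_function_mult:
  assumes "smooth_fun \<phi>" "test_function U \<kappa>"
  shows "test_function U (\<lambda>x. \<phi> x * \<kappa> x)"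
  using assms smooth_fun_mult[OF assms(1) test_function_smooth[OF assms(2)]]
    closure_subset[of "{x. \<kappa> x \<noteq> 0}"]
  by (intro test_functionI[where K = "closure {x. \<kappa> x \<noteq> 0}"]) (auto simp: test_function_def)

lemma integral_by_parts_C1:
  fixes f g :: "real \<Rightarrow> real"
  assumes "p \<le> q"
    and f: "\<And>x. x \<in> {p..q} \<Longrightarrow> (f has_vector_derivative f' x) (at x within {p..q})"
    and g: "\<And>x. x \<in> {p..q} \<Longrightarrow> (g has_vector_derivative g' x) (at x within {p..q})"
    and cont: "continuous_on {p..q} f'" "continuous_on {p..q} g'"
  shows "integral {p..q} (\<lambda>x. f x * g' x) = f q * g q - f p * g p - integral {p..q} (\<lambda>x. f' x * g x)"
proof -
  have c: "continuous_on {p..q} f" "continuous_on {p..q} g"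
    using f g by (meson continuous_on_eq_continuous_within has_vector_derivative_continuous)+
  have "((\<lambda>x. f x * g' x + f' x * g x) has_integral f q * g q - f p * g p) {p..q}"
    using \<open>p \<le> q\<close> has_vector_derivative_mult[OF f g] by (intro fundamental_theorem_of_calculus) auto
  then have "integral {p..q} (\<lambda>x. f x * g' x + f' x * g x) = f q * g q - f p * g p"
    by (rule integral_unique)
  moreover have "integral {p..q} (\<lambda>x. f x * g' x + f' x * g x) =
      integral {p..q} (\<lambda>x. f x * g' x) + integral {p..q} (\<lambda>x. f' x * g x)"
    using c cont by (intro integral_add integrable_continuous_interval continuous_intros)
  ultimately show ?thesis by linarith
qed

section \<open>Integration by parts up to the boundary\<close>

text \<open>
  Testing with \<open>\<phi> * \<kappa>\<^sub>n\<close> loses only the integral of \<open>P * \<phi> * \<kappa>\<^sub>n'\<close> in the limit, and that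
  one vanishes when \<open>P\<close> does at both endpoints; in general a linear function is subtracted.
\<close>

lemma integral_times_deriv_smooth_zero_endpoints:
  fixes P g \<phi> :: "real \<Rightarrow> real"
  assumes "p < q"
    and g: "g \<in> borel_measurable borel" "\<And>x. \<bar>g x\<bar> \<le> M"
    and lip: "L-lipschitz_on {p..q} P" and zero: "P p = 0" "P q = 0"
    and weak: "\<And>\<psi>. test_function {p<..<q} \<psi> \<Longrightarrow>
      integral {p..q} (\<lambda>x. P x * deriv \<psi> x) = - integral {p..q} (\<lambda>x. g x * \<psi> x)"
    and \<phi>: "smooth_fun \<phi>"
  shows "integral {p..q} (\<lambda>x. P x * deriv \<phi> x) = - integral {p..q} (\<lambda>x. g x * \<phi> x)"
proof -
  obtain \<kappa> :: "nat \<Rightarrow> real \<Rightarrow> real" and C where \<kappa>: "\<And>n. smooth_fun (\<kappa> n)" "\<And>n. test_function {p<..<q} (\<kappa> n)"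
    "\<And>n x. \<bar>\<kappa> n x\<bar> \<le> 1" "\<And>x. x \<in> {p<..<q} \<Longrightarrow> (\<lambda>n. \<kappa> n x) \<longlonglongrightarrow> 1"
    and d\<kappa>: "\<And>x. x \<in> {p<..<q} \<Longrightarrow> (\<lambda>n. deriv (\<kappa> n) x) \<longlonglongrightarrow> 0"
      "\<And>n x. x \<in> {p..q} \<Longrightarrow> \<bar>deriv (\<kappa> n) x\<bar> * min (x - p) (q - x) \<le> C"
    using smooth_cutoff_exists[OF \<open>p < q\<close>] by metis
  have contP: "continuous_on {p..q} P"
    using lip by (rule lipschitz_on_continuous_on)
  note cont = contP smooth_fun_continuous[OF \<phi>] smooth_fun_continuous[OF smooth_fun_deriv[OF \<phi>]]
    smooth_fun_continuous[OF \<kappa>(1)] smooth_fun_continuous[OF smooth_fun_deriv[OF \<kappa>(1)]]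
  obtain B where B: "\<And>x. x \<in> {p..q} \<Longrightarrow> \<bar>\<phi> x\<bar> \<le> B" "0 \<le> B"
  proof -
    have "bounded (\<phi> ` {p..q})"
      using cont(2) by (intro compact_imp_bounded compact_continuous_image) auto
    then obtain b where "0 < b" "\<forall>x\<in>{p..q}. \<bar>\<phi> x\<bar> \<le> b"
      by (auto simp: bounded_pos)
    then show ?thesis
      by (intro that[of b]) auto
  qed
  have L: "0 \<le> L" using lip by (rule lipschitz_on_nonneg)
  \<comment> \<open>The Lipschitz bound is used towards whichever endpoint is nearer, where
    \<open>P\<close> is zero.\<close>
  have P_le: "\<bar>P x\<bar> \<le> L * min (x - p) (q - x)" if "x \<in> {p..q}" for x
  proof -
    have "\<bar>P x\<bar> \<le> L * (x - p)" "\<bar>P x\<bar> \<le> L * (q - x)"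
      using lipschitz_onD[OF lip, of x p] lipschitz_onD[OF lip, of x q] that zero \<open>p < q\<close>
      by (auto simp: dist_real_def)
    then show ?thesis by (auto simp: min_def)
  qed
  have lim1: "(\<lambda>n. integral {p..q} (\<lambda>x. (P x * deriv \<phi> x) * \<kappa> n x)) \<longlonglongrightarrow> integral {p..q} (\<lambda>x. P x * deriv \<phi> x)"
    using \<kappa>(3,4) cont
    by (intro integral_times_cutoff_tendsto absolutely_integrable_continuous_real continuous_intros) auto
  have lim2: "(\<lambda>n. integral {p..q} (\<lambda>x. (g x * \<phi> x) * \<kappa> n x)) \<longlonglongrightarrow> integral {p..q} (\<lambda>x. g x * \<phi> x)"
    using \<kappa>(3,4) cont g
    by (intro integral_times_cutoff_tendsto absolutely_integrable_bounded_times_continuous) auto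
  have "(\<lambda>n. integral {p<..<q} (\<lambda>x. (P x * \<phi> x) * deriv (\<kappa> n) x)) \<longlonglongrightarrow> integral {p<..<q} (\<lambda>_. 0)"
  \<comment> \<open>The majorant multiplies \<bar>P\<bar> \<le> L dist, \<bar>\<phi>\<bar> \<le> B
    and \<bar>\<kappa>_n'\<bar> dist \<le> C, where dist is the distance to the nearer endpoint.
    Pointwise convergence to 0 holds at every interior point.\<close>
  proof (rule dominated_convergence(2)[where h = "\<lambda>_. L * B * C"])
    show "(\<lambda>x. (P x * \<phi> x) * deriv (\<kappa> n) x) integrable_on {p<..<q}" for n
      unfolding integrable_on_open_interval_real using cont
      by (intro integrable_continuous_interval continuous_intros) auto
    show "(\<lambda>_. L * B * C) integrable_on {p<..<q}"
      unfolding integrable_on_open_interval_real by (rule integrable_const_ivl)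
    fix n x assume "x \<in> {p<..<q}"
    then have x: "x \<in> {p..q}" by auto
    have "\<bar>P x\<bar> * \<bar>\<phi> x\<bar> * \<bar>deriv (\<kappa> n) x\<bar> \<le> (L * min (x - p) (q - x)) * B * \<bar>deriv (\<kappa> n) x\<bar>"
      using P_le[OF x] B(1)[OF x] B(2) L x by (intro mult_right_mono mult_mono) auto
    also have "\<dots> = L * B * (\<bar>deriv (\<kappa> n) x\<bar> * min (x - p) (q - x))"
      by (simp add: algebra_simps)
    also have "\<dots> \<le> L * B * C"
      using d\<kappa>(2)[OF x] L B(2) by (intro mult_left_mono) auto
    finally show "norm (P x * \<phi> x * deriv (\<kappa> n) x) \<le> L * B * C"
      by (simp add: abs_mult)
  next
    fix x assume "x \<in> {p<..<q}"
    from tendsto_mult_left[OF d\<kappa>(1)[OF this], of "P x * \<phi> x"]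
    show "(\<lambda>n. P x * \<phi> x * deriv (\<kappa> n) x) \<longlonglongrightarrow> 0" by simp
  qed
  then have lim3: "(\<lambda>n. integral {p..q} (\<lambda>x. (P x * \<phi> x) * deriv (\<kappa> n) x)) \<longlonglongrightarrow> 0"
    by (simp add: integral_open_interval_real)
  have "integral {p..q} (\<lambda>x. (P x * \<phi> x) * deriv (\<kappa> n) x) + integral {p..q} (\<lambda>x. (P x * deriv \<phi> x) * \<kappa> n x)
      = - integral {p..q} (\<lambda>x. (g x * \<phi> x) * \<kappa> n x)" for n
  proof -
    have "integral {p..q} (\<lambda>x. (P x * \<phi> x) * deriv (\<kappa> n) x) + integral {p..q} (\<lambda>x. (P x * deriv \<phi> x) * \<kappa> n x)
      = integral {p..q} (\<lambda>x. (P x * \<phi> x) * deriv (\<kappa> n) x + (P x * deriv \<phi> x) * \<kappa> n x)"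
      using cont by (intro integral_add[symmetric] integrable_continuous_interval continuous_intros) auto
    also have "\<dots> = integral {p..q} (\<lambda>x. P x * deriv (\<lambda>x. \<phi> x * \<kappa> n x) x)"
      by (simp add: deriv_mult_smooth[OF \<phi> \<kappa>(1)] algebra_simps)
    also have "\<dots> = - integral {p..q} (\<lambda>x. g x * (\<phi> x * \<kappa> n x))"
      by (rule weak[OF test_function_mult[OF \<phi> \<kappa>(2)]])
    finally show ?thesis by (simp add: mult.assoc)
  qed
  then have "(\<lambda>n. - integral {p..q} (\<lambda>x. (g x * \<phi> x) * \<kappa> n x)) \<longlonglongrightarrow> 0 + integral {p..q} (\<lambda>x. P x * deriv \<phi> x)"
    using tendsto_add[OF lim3 lim1] by simp
  from LIMSEQ_unique[OF this tendsto_minus[OF lim2]] show ?thesis by simp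
qed

lemma smooth_fun_has_vector_derivative:
  assumes "smooth_fun \<phi>"
  shows "(\<phi> has_vector_derivative deriv \<phi> x) (at x within A)"
  using smooth_fun_DERIV[OF assms] has_vector_derivative_at_within
  by (blast intro: has_real_derivative_iff_has_vector_derivative[THEN iffD1])

text \<open>Let \<open>l\<close> be the affine interpolant of \<open>P\<close> at the endpoints. The
  difference \<open>P - l\<close> vanishes there and has the bounded weak derivative
  \<open>g - s\<close>, so the zero-endpoint case applies to it. For \<open>l\<close> the formula is
  classical, and it supplies the boundary terms.\<close>

lemma weak_second_deriv_by_parts:
  fixes P F g \<phi> :: "real \<Rightarrow> real"
  assumes "p < q" and w: "weak_second_deriv p q M F g"
    and F: "\<And>x. x \<in> {p..q} \<Longrightarrow> (F has_vector_derivative P x) (at x within {p..q})"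
    and lip: "L-lipschitz_on {p..q} P" and \<phi>: "smooth_fun \<phi>"
  shows "integral {p..q} (\<lambda>x. P x * deriv \<phi> x) =
    P q * \<phi> q - P p * \<phi> p - integral {p..q} (\<lambda>x. g x * \<phi> x)"
proof -
  have g: "g \<in> borel_measurable borel" "\<And>x. \<bar>g x\<bar> \<le> M"
    using w by (auto simp: weak_second_deriv_def)
  have contP: "continuous_on {p..q} P"
    using lip by (rule lipschitz_on_continuous_on)
  define s where "s = (P q - P p) / (q - p)"
  define l where "l x = P p + s * (x - p)" for x
  have l: "l p = P p" "l q = P q"
    using \<open>p < q\<close> by (auto simp: l_def s_def)
  have dl: "(l has_vector_derivative s) (at x within A)" for x A
    unfolding l_def by (auto intro!: derivative_eq_intros)
  have contl: "continuous_on {p..q} l"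
    unfolding l_def[abs_def] by (intro continuous_intros)
  have int: "(\<lambda>x. g x * \<psi> x) integrable_on {p..q}" "(\<lambda>x. s * \<psi> x) integrable_on {p..q}"
    "(\<lambda>x. P x * deriv \<psi> x) integrable_on {p..q}" "(\<lambda>x. l x * deriv \<psi> x) integrable_on {p..q}"
    if \<psi>: "smooth_fun \<psi>" for \<psi>
    using set_lebesgue_integral_eq_integral(1)[OF absolutely_integrable_bounded_times_continuous[OF g smooth_fun_continuous[OF \<psi>]]]
      contP contl smooth_fun_continuous[OF \<psi>, of "{p..q}"] smooth_fun_continuous[OF smooth_fun_deriv[OF \<psi>], of "{p..q}"]
    by (auto intro!: integrable_continuous_interval continuous_intros)
  have parts_l: "integral {p..q} (\<lambda>x. l x * deriv \<psi> x) = P q * \<psi> q - P p * \<psi> p - integral {p..q} (\<lambda>x. s * \<psi> x)"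
    if \<psi>: "smooth_fun \<psi>" for \<psi>
    using integral_by_parts_C1[of p q l "\<lambda>_. s" \<psi> "deriv \<psi>"] \<open>p < q\<close> dl l
      smooth_fun_has_vector_derivative[OF \<psi>] smooth_fun_continuous[OF smooth_fun_deriv[OF \<psi>]] by auto
  \<comment> \<open>The hypothesis relates \<open>F\<close> to the second derivative of the test
    function. One classical integration by parts, whose boundary terms vanish, lowers it to a
    first-order identity between \<open>P\<close> and \<open>g\<close>.\<close>
  have parts_F: "integral {p..q} (\<lambda>x. P x * deriv \<psi> x) = - integral {p..q} (\<lambda>x. g x * \<psi> x)"
    if \<psi>: "test_function {p<..<q} \<psi>" for \<psi>
  proof -
    have s: "smooth_fun (deriv \<psi>)"
      using \<psi> by (intro smooth_fun_deriv test_function_smooth)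
    have "integral {p..q} (\<lambda>x. F x * deriv (deriv \<psi>) x) =
        F q * deriv \<psi> q - F p * deriv \<psi> p - integral {p..q} (\<lambda>x. P x * deriv \<psi> x)"
      using \<open>p < q\<close> F smooth_fun_has_vector_derivative[OF s] contP smooth_fun_continuous[OF smooth_fun_deriv[OF s]]
      by (intro integral_by_parts_C1) auto
    moreover have "deriv \<psi> p = 0" "deriv \<psi> q = 0"
      using test_function_eq_0[OF test_function_deriv[OF \<psi>]] by auto
    ultimately show ?thesis
      using w \<psi> by (simp add: weak_second_deriv_def)
  qed
  have "integral {p..q} (\<lambda>x. (P x - l x) * deriv \<phi> x) = - integral {p..q} (\<lambda>x. (g x - s) * \<phi> x)"
  proof (rule integral_times_deriv_smooth_zero_endpoints[OF \<open>p < q\<close> _ _ _ _ _ _ \<phi>])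
    show "(\<lambda>x. g x - s) \<in> borel_measurable borel" using g(1) by simp
    show "\<bar>g x - s\<bar> \<le> M + \<bar>s\<bar>" for x using g(2)[of x] by linarith
    have "\<bar>s\<bar>-lipschitz_on {p..q} l"
      unfolding l_def by (rule lipschitz_onI) (auto simp: dist_real_def abs_mult[symmetric] algebra_simps)
    from lipschitz_on_diff[OF lip this] show "(L + \<bar>s\<bar>)-lipschitz_on {p..q} (\<lambda>x. P x - l x)" .
    fix \<psi> assume \<psi>: "test_function {p<..<q} \<psi>"
    then have s: "smooth_fun \<psi>" by (rule test_function_smooth)
    have "\<psi> p = 0" "\<psi> q = 0"
      using test_function_eq_0[OF \<psi>] by auto
    then show "integral {p..q} (\<lambda>x. (P x - l x) * deriv \<psi> x) = - integral {p..q} (\<lambda>x. (g x - s) * \<psi> x)"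
      using parts_l[OF s] parts_F[OF \<psi>] integral_diff[OF int(3,4)[OF s]] integral_diff[OF int(1,2)[OF s]]
      by (simp add: left_diff_distrib)
  qed (use l in auto)
  then show ?thesis
    using parts_l[OF \<phi>] integral_diff[OF int(3,4)[OF \<phi>]] integral_diff[OF int(1,2)[OF \<phi>]]
    by (simp add: left_diff_distrib)
qed

section \<open>Restriction, rescaling and gluing\<close>

lemma integral_affine:
  fixes f :: "real \<Rightarrow> real"
  assumes "f integrable_on {m * p + c..m * q + c}" "0 < m"
  shows "integral {p..q} (\<lambda>t. f (m * t + c)) = integral {m * p + c..m * q + c} f / m"
proof (rule integral_unique)
  have "(f has_integral integral {m * p + c..m * q + c} f) (cbox (m * p + c) (m * q + c))"
    using assms(1) by (simp add: integrable_integral)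
  from has_integral_affinity'[OF this \<open>0 < m\<close>, of c]
  show "((\<lambda>t. f (m * t + c)) has_integral integral {m * p + c..m * q + c} f / m) {p..q}"
    using \<open>0 < m\<close> by (simp add: divide_inverse mult.commute[of _ "inverse m"] mult.assoc[symmetric])
qed

text \<open>A test function on the smaller interval is also one on the larger, and both integrands
  vanish outside the smaller interval.\<close>

lemma weak_second_deriv_subinterval:
  assumes w: "weak_second_deriv p q M F g" and "p \<le> p'" "q' \<le> q"
  shows "weak_second_deriv p' q' M F g"
  unfolding weak_second_deriv_def
proof (intro conjI allI impI)
  fix \<phi> assume \<phi>: "test_function {p'<..<q'} \<phi>"
  have eq: "integral {p'..q'} f = integral {p..q} f" if "\<And>x. x \<notin> {p'<..<q'} \<Longrightarrow> f x = 0"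
    for f :: "real \<Rightarrow> real"
  proof (rule integral_spike_set)
    have "{x \<in> {p'..q'} - {p..q}. f x \<noteq> 0} = {}" "{x \<in> {p..q} - {p'..q'}. f x \<noteq> 0} = {}"
      using assms(2,3) that by fastforce+
    then show "negligible {x \<in> {p'..q'} - {p..q}. f x \<noteq> 0}"
      "negligible {x \<in> {p..q} - {p'..q'}. f x \<noteq> 0}"
      by (simp_all only: negligible_empty)
  qed
  have "test_function {p<..<q} \<phi>"
    using assms(2,3) by (intro test_function_mono[OF \<phi>]) auto
  then have "integral {p..q} (\<lambda>x. F x * deriv (deriv \<phi>) x) = integral {p..q} (\<lambda>x. g x * \<phi> x)"
    using w by (simp add: weak_second_deriv_def)
  moreover have "integral {p'..q'} (\<lambda>x. F x * deriv (deriv \<phi>) x) = integral {p..q} (\<lambda>x. F x * deriv (deriv \<phi>) x)"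
    by (rule eq) (simp add: test_function_eq_0[OF test_function_deriv[OF test_function_deriv[OF \<phi>]]])
  moreover have "integral {p'..q'} (\<lambda>x. g x * \<phi> x) = integral {p..q} (\<lambda>x. g x * \<phi> x)"
    by (rule eq) (simp add: test_function_eq_0[OF \<phi>])
  ultimately show "integral {p'..q'} (\<lambda>x. F x * deriv (deriv \<phi>) x) = integral {p'..q'} (\<lambda>x. g x * \<phi> x)"
    by simp
qed (use w in \<open>auto simp: weak_second_deriv_def\<close>)

lemma deriv_smooth_affine:
  assumes "smooth_fun \<phi>"
  shows "deriv (\<lambda>x. \<phi> (m * x + c)) = (\<lambda>x. m * deriv \<phi> (m * x + c))"
proof
  fix x
  have "((\<lambda>x. m * x + c) has_real_derivative m) (at x)"
    by (auto intro!: derivative_eq_intros)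
  from DERIV_chain2[OF smooth_fun_DERIV[OF assms] this]
  show "deriv (\<lambda>x. \<phi> (m * x + c)) x = m * deriv \<phi> (m * x + c)"
    by (intro DERIV_imp_deriv) (simp add: mult.commute)
qed

lemma deriv2_smooth_affine:
  assumes "smooth_fun \<phi>"
  shows "deriv (deriv (\<lambda>x. \<phi> (m * x + c))) x = m\<^sup>2 * deriv (deriv \<phi>) (m * x + c)"
proof -
  have "((\<lambda>x. m * x + c) has_real_derivative m) (at x)"
    by (auto intro!: derivative_eq_intros)
  from DERIV_cmult[OF DERIV_chain2[OF smooth_fun_DERIV[OF smooth_fun_deriv[OF assms]] this], of m]
  show ?thesis
    unfolding deriv_smooth_affine[OF assms]
    by (intro DERIV_imp_deriv) (simp add: power2_eq_square mult_ac)
qed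

lemma test_function_affine:
  assumes "test_function {m * p + c<..<m * q + c} \<phi>" "0 < m"
  shows "test_function {p<..<q} (\<lambda>x. \<phi> (m * x + c))"
proof (rule test_functionI)
  let ?K = "closure {x. \<phi> x \<noteq> 0}"
  let ?h = "\<lambda>y. (1 / m) * y + - c / m"
  have inv: "?h (m * x + c) = x" for x
    using assms(2) by (simp add: field_simps)
  show "smooth_fun (\<lambda>x. \<phi> (m * x + c))"
    by (rule smooth_fun_affine[OF test_function_smooth[OF assms(1)]])
  show "compact (?h ` ?K)"
    using assms(1) by (intro compact_continuous_image continuous_intros) (simp add: test_function_def)
  show "\<phi> (m * x + c) = 0" if "x \<notin> ?h ` ?K" for x
  proof (rule ccontr)
    assume "\<phi> (m * x + c) \<noteq> 0"
    then have "m * x + c \<in> ?K"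
      using closure_subset[of "{x. \<phi> x \<noteq> 0}"] by auto
    then have "?h (m * x + c) \<in> ?h ` ?K" by (rule imageI)
    then show False using that inv by simp
  qed
  show "?h ` ?K \<subseteq> {p<..<q}"
  proof clarify
    fix y assume "y \<in> ?K"
    then have "y \<in> {m * p + c<..<m * q + c}"
      using assms(1) by (auto simp: test_function_def)
    then show "?h y \<in> {p<..<q}"
      using assms(2) by (auto simp: field_simps)
  qed
qed

text \<open>The test function is moved to the other interval as \<psi>, so that \<phi>(t) = \<psi>(m
  t + c). Then \<phi>'' brings the factor m^2, while the factors 1/m from the change of variables
  occur on both sides. With \<open>0 \<le> A\<close> the bound scales like the function
  itself.\<close>

lemma weak_second_deriv_affine:
  assumes w: "weak_second_deriv (m * p + c) (m * q + c) M F g"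
    and F: "continuous_on {m * p + c..m * q + c} F" and "p \<le> q" "0 < m" "0 \<le> A"
  shows "weak_second_deriv p q (A * m\<^sup>2 * M) (\<lambda>t. A * F (m * t + c) + B) (\<lambda>t. A * m\<^sup>2 * g (m * t + c))"
  unfolding weak_second_deriv_def
proof (intro conjI allI impI)
  have g: "g \<in> borel_measurable borel" "\<And>x. \<bar>g x\<bar> \<le> M"
    using w by (auto simp: weak_second_deriv_def)
  then show "(\<lambda>t. A * m\<^sup>2 * g (m * t + c)) \<in> borel_measurable borel"
    by measurable
  show "\<bar>A * m\<^sup>2 * g (m * t + c)\<bar> \<le> A * m\<^sup>2 * M" for t
    using g(2) \<open>0 \<le> A\<close> by (simp add: abs_mult mult_left_mono)
  fix \<phi> assume \<phi>: "test_function {p<..<q} \<phi>"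
  then have s: "smooth_fun \<phi>" by (rule test_function_smooth)
  define \<psi> where "\<psi> x = \<phi> ((1 / m) * x + - c / m)" for x
  have s\<psi>: "smooth_fun \<psi>"
    unfolding \<psi>_def[abs_def] by (rule smooth_fun_affine[OF s])
  have cancel: "(1 / m) * (m * t + c) + - c / m = t" for t
    using \<open>0 < m\<close> by (simp add: field_simps)
  have ends: "(1 / m) * (m * p + c) + - c / m = p" "(1 / m) * (m * q + c) + - c / m = q"
    by (simp_all only: cancel)
  have "test_function {m * p + c<..<m * q + c} \<psi>"
    unfolding \<psi>_def[abs_def]
    by (rule test_function_affine) (use \<phi> ends \<open>0 < m\<close> in simp_all)
  then have w\<psi>: "integral {m * p + c..m * q + c} (\<lambda>x. F x * deriv (deriv \<psi>) x) =
      integral {m * p + c..m * q + c} (\<lambda>x. g x * \<psi> x)"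
    using w by (simp add: weak_second_deriv_def)
  have \<phi>\<psi>: "\<phi> t = \<psi> (m * t + c)" for t
    by (simp only: \<psi>_def cancel)
  then have \<phi>_eq: "\<phi> = (\<lambda>t. \<psi> (m * t + c))" by blast
  have dd: "deriv (deriv \<phi>) t = m\<^sup>2 * deriv (deriv \<psi>) (m * t + c)" for t
    by (subst \<phi>_eq) (rule deriv2_smooth_affine[OF s\<psi>])
  have sd: "smooth_fun (deriv \<psi>)" "smooth_fun (deriv (deriv \<psi>))"
    using s\<psi> by (auto intro: smooth_fun_deriv)
  have int1: "(\<lambda>x. F x * deriv (deriv \<psi>) x) integrable_on {m * p + c..m * q + c}"
    using F smooth_fun_continuous[OF sd(2)] by (intro integrable_continuous_interval continuous_intros)
  have int2: "(\<lambda>x. g x * \<psi> x) integrable_on {m * p + c..m * q + c}"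
    by (intro set_lebesgue_integral_eq_integral absolutely_integrable_bounded_times_continuous[OF g]
        smooth_fun_continuous[OF s\<psi>])
  \<comment> \<open>This removes the additive constant \<open>B\<close>: the integral of \<phi>'' is
    a difference of two endpoint values of \<phi>', both zero.\<close>
  have zero: "((\<lambda>t. deriv (deriv \<phi>) t) has_integral 0) {p..q}"
  proof -
    have "((\<lambda>t. deriv (deriv \<phi>) t) has_integral deriv \<phi> q - deriv \<phi> p) {p..q}"
      using \<open>p \<le> q\<close> smooth_fun_has_vector_derivative[OF smooth_fun_deriv[OF s]]
      by (intro fundamental_theorem_of_calculus) auto
    then show ?thesis
      using test_function_eq_0[OF test_function_deriv[OF \<phi>]] by simp
  qed
  have cont: "continuous_on {p..q} (\<lambda>t. F (m * t + c))"
    using \<open>0 < m\<close> by (intro continuous_on_compose2[OF F] continuous_intros) auto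
  have "integral {p..q} (\<lambda>t. (A * F (m * t + c) + B) * deriv (deriv \<phi>) t) =
      integral {p..q} (\<lambda>t. A * F (m * t + c) * deriv (deriv \<phi>) t + B * deriv (deriv \<phi>) t)"
    by (simp add: algebra_simps)
  also have "\<dots> = integral {p..q} (\<lambda>t. A * F (m * t + c) * deriv (deriv \<phi>) t) +
      integral {p..q} (\<lambda>t. B * deriv (deriv \<phi>) t)"
    using cont smooth_fun_continuous[OF smooth_fun_deriv[OF smooth_fun_deriv[OF s]]]
    by (intro integral_add integrable_continuous_interval continuous_intros)
  also have "integral {p..q} (\<lambda>t. B * deriv (deriv \<phi>) t) = 0"
    using integral_unique[OF has_integral_mult_right[OF zero, of B]] by simp
  also have "integral {p..q} (\<lambda>t. A * F (m * t + c) * deriv (deriv \<phi>) t) =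
      (A * m\<^sup>2) * integral {p..q} (\<lambda>t. F (m * t + c) * deriv (deriv \<psi>) (m * t + c))"
    by (subst integral_mult_right[symmetric]) (simp add: dd mult_ac)
  also have "\<dots> = (A * m\<^sup>2) * integral {p..q} (\<lambda>t. g (m * t + c) * \<psi> (m * t + c))"
    using integral_affine[OF int1 \<open>0 < m\<close>] integral_affine[OF int2 \<open>0 < m\<close>] w\<psi> by simp
  also have "\<dots> = integral {p..q} (\<lambda>t. A * m\<^sup>2 * g (m * t + c) * \<phi> t)"
    by (subst integral_mult_right[symmetric]) (simp add: \<phi>\<psi> mult_ac)
  finally show "integral {p..q} (\<lambda>t. (A * F (m * t + c) + B) * deriv (deriv \<phi>) t) =
      integral {p..q} (\<lambda>t. A * m\<^sup>2 * g (m * t + c) * \<phi> t)" by simp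
qed

text \<open>The derivative is carried as an explicit function \<open>P\<close> because
  \<open>deriv_within\<close> refers to the interval, which changes under restriction, rescaling and
  gluing. A formula for \<open>P\<close> survives these operations.\<close>

definition C11_with_deriv :: "real \<Rightarrow> real \<Rightarrow> (real \<Rightarrow> real) \<Rightarrow> (real \<Rightarrow> real) \<Rightarrow> bool" where
  "C11_with_deriv p q F P \<longleftrightarrow>
    (\<forall>x\<in>{p..q}. (F has_vector_derivative P x) (at x within {p..q})) \<and> (\<exists>L. L-lipschitz_on {p..q} P)"

lemma C11_iff:
  assumes "p < q"
  shows "F \<in> C11 {p..q} \<longleftrightarrow> C11_with_deriv p q F (deriv_within {p..q} F)"
  unfolding C11_def C11_with_deriv_def differentiable_on_def
  by (auto simp: vector_derivative_works[symmetric])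

lemma C11_with_deriv_eq:
  assumes "p < q" "C11_with_deriv p q F P" "x \<in> {p..q}"
  shows "deriv_within {p..q} F x = P x"
  using assms by (auto simp: C11_with_deriv_def intro: vector_derivative_within_closed_interval)

lemma C11_with_deriv_imp_C11:
  assumes "p < q" "C11_with_deriv p q F P"
  shows "F \<in> C11 {p..q}"
proof -
  obtain L where "L-lipschitz_on {p..q} P" and F: "\<forall>x\<in>{p..q}. (F has_vector_derivative P x) (at x within {p..q})"
    using assms(2) by (auto simp: C11_with_deriv_def)
  then have "L-lipschitz_on {p..q} (deriv_within {p..q} F)"
    by (rule_tac lipschitz_on_transform[of L _ P]) (simp_all add: C11_with_deriv_eq[OF assms])
  then show ?thesis
    unfolding C11_def differentiable_on_def using F differentiableI_vector by blast
qed

lemma C11_with_deriv_continuous: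
  assumes "C11_with_deriv p q F P"
  shows "continuous_on {p..q} F"
  using assms has_vector_derivative_continuous
  by (fastforce simp: C11_with_deriv_def continuous_on_eq_continuous_within)

lemma C11_with_deriv_affine:
  assumes F: "C11_with_deriv p q F P" and "0 < m" "p \<le> m * p' + c" "m * q' + c \<le> q"
  shows "C11_with_deriv p' q' (\<lambda>t. A * F (m * t + c) + B) (\<lambda>t. A * m * P (m * t + c))"
proof -
  have into: "m * t + c \<in> {p..q}" if "t \<in> {p'..q'}" for t
    using that assms(2-4) mult_left_mono[of p' t m] mult_left_mono[of t q' m]
    by (simp del: mult_le_cancel_left_pos, linarith)
  obtain L where L: "L-lipschitz_on {p..q} P" using F by (auto simp: C11_with_deriv_def)
  have "((\<lambda>t. A * F (m * t + c) + B) has_vector_derivative A * m * P (m * t + c)) (at t within {p'..q'})"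
    if t: "t \<in> {p'..q'}" for t
  proof -
    have a: "((\<lambda>t. m * t + c) has_vector_derivative m) (at t within {p'..q'})"
      by (auto intro!: derivative_eq_intros)
    have "(F has_vector_derivative P (m * t + c)) (at (m * t + c) within {p..q})"
      using F into[OF t] by (simp add: C11_with_deriv_def)
    then have "(F has_vector_derivative P (m * t + c)) (at (m * t + c) within (\<lambda>t. m * t + c) ` {p'..q'})"
      by (rule has_vector_derivative_within_subset) (use into in auto)
    from vector_diff_chain_within[OF a this]
    have "((\<lambda>t. F (m * t + c)) has_vector_derivative m * P (m * t + c)) (at t within {p'..q'})"
      by (simp add: o_def)
    from has_vector_derivative_add[OF has_vector_derivative_mult_right[OF this, of A] has_vector_derivative_const[of B]]
    show ?thesis by (simp add: mult.assoc)
  qed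
  moreover have "(\<bar>A * m\<bar> * (L * m))-lipschitz_on {p'..q'} (\<lambda>t. A * m * P (m * t + c))"
  proof (rule lipschitz_onI)
    fix s t assume "s \<in> {p'..q'}" "t \<in> {p'..q'}"
    then have "\<bar>P (m * s + c) - P (m * t + c)\<bar> \<le> L * \<bar>(m * s + c) - (m * t + c)\<bar>"
      using lipschitz_onD[OF L into into] by (simp add: dist_real_def)
    also have "\<dots> = L * m * \<bar>s - t\<bar>"
      using \<open>0 < m\<close> by (simp add: right_diff_distrib[symmetric] abs_mult)
    finally have "\<bar>A * m\<bar> * \<bar>P (m * s + c) - P (m * t + c)\<bar> \<le> \<bar>A * m\<bar> * (L * m * \<bar>s - t\<bar>)"
      by (intro mult_left_mono) auto
    then show "dist (A * m * P (m * s + c)) (A * m * P (m * t + c)) \<le> \<bar>A * m\<bar> * (L * m) * dist s t"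
      by (simp add: dist_real_def abs_mult[symmetric] right_diff_distrib mult.assoc)
  qed (use L \<open>0 < m\<close> in \<open>simp add: lipschitz_on_nonneg\<close>)
  ultimately show ?thesis
    by (auto simp: C11_with_deriv_def)
qed

lemma C11_with_deriv_glue:
  assumes "p \<le> m" "m \<le> q"
    and 1: "C11_with_deriv p m F P" and 2: "C11_with_deriv m q G Q"
    and eq: "F m = G m" "P m = Q m"
  shows "C11_with_deriv p q (\<lambda>x. if x \<le> m then F x else G x) (\<lambda>x. if x \<le> m then P x else Q x)"
  unfolding C11_with_deriv_def
proof (intro conjI ballI)
  obtain K L where "K-lipschitz_on {p..m} P" "L-lipschitz_on {m..q} Q"
    using 1 2 by (auto simp: C11_with_deriv_def)
  from lipschitz_on_concat_max[OF this eq(2)]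
  show "\<exists>L. L-lipschitz_on {p..q} (\<lambda>x. if x \<le> m then P x else Q x)" ..
  fix x assume x: "x \<in> {p..q}"
  have clo: "{p..m} \<union> (closure {p..m} \<inter> closure {m..q}) = {p..m}"
    "{m..q} \<union> (closure {p..m} \<inter> closure {m..q}) = {m..q}"
    using assms(1,2) by auto
  have mid: "x = m" if "x \<in> closure {p..m}" "x \<in> closure {m..q}"
    using that by auto
  have "((\<lambda>x. if x \<in> {p..m} then F x else G x) has_vector_derivative
      (if x \<in> {p..m} then P x else Q x)) (at x within {p..q})"
  proof (rule has_vector_derivative_If_within_closures[where T = "{m..q}"])
    show "x \<in> {p..m} \<union> {m..q}" "{p..q} = {p..m} \<union> {m..q}"
      using x assms(1,2) by auto
    show "F x = G x" "P x = Q x" if "x \<in> closure {p..m}" "x \<in> closure {m..q}"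
      using mid[OF that] eq by simp_all
    show "(F has_vector_derivative P x) (at x within {p..m} \<union> (closure {p..m} \<inter> closure {m..q}))"
      if "x \<in> {p..m} \<union> (closure {p..m} \<inter> closure {m..q})"
      using 1 that unfolding clo by (simp add: C11_with_deriv_def)
    show "(G has_vector_derivative Q x) (at x within {m..q} \<union> (closure {p..m} \<inter> closure {m..q}))"
      if "x \<in> {m..q} \<union> (closure {p..m} \<inter> closure {m..q})"
      using 2 that unfolding clo by (simp add: C11_with_deriv_def)
  qed
  then have "((\<lambda>x. if x \<in> {p..m} then F x else G x) has_vector_derivative
      (if x \<le> m then P x else Q x)) (at x within {p..q})"
    using x by simp
  then show "((\<lambda>x. if x \<le> m then F x else G x) has_vector_derivative
      (if x \<le> m then P x else Q x)) (at x within {p..q})"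
    by (rule has_vector_derivative_transform[rotated 2]) (use x in auto)
qed

text \<open>A test function on (p, q) need not vanish at \<open>m\<close>, so integrating by parts
  on the two pieces leaves \<open>P m * \<phi> m\<close> and \<open>- Q m * \<phi> m\<close>. Equal
  slopes cancel them; a jump would leave a point mass at \<open>m\<close>.\<close>

lemma weak_second_deriv_glue:
  assumes "p < m" "m < q"
    and 1: "C11_with_deriv p m F P" "weak_second_deriv p m M F g"
    and 2: "C11_with_deriv m q G Q" "weak_second_deriv m q M G h"
    and eq: "F m = G m" "P m = Q m"
  shows "weak_second_deriv p q M (\<lambda>x. if x \<le> m then F x else G x) (\<lambda>x. if x \<le> m then g x else h x)"
    (is "weak_second_deriv p q M ?F ?g")
  unfolding weak_second_deriv_def
proof (intro conjI allI impI)
  define R where "R x = (if x \<le> m then P x else Q x)" for x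
  have g: "g \<in> borel_measurable borel" "h \<in> borel_measurable borel" "\<And>x. \<bar>g x\<bar> \<le> M" "\<And>x. \<bar>h x\<bar> \<le> M"
    using 1 2 by (auto simp: weak_second_deriv_def)
  then show meas: "?g \<in> borel_measurable borel"
    by measurable
  show bound: "\<bar>?g x\<bar> \<le> M" for x
    using g by simp
  have F: "C11_with_deriv p q ?F R"
    unfolding R_def[abs_def] using assms by (intro C11_with_deriv_glue) auto
  fix \<phi> assume \<phi>: "test_function {p<..<q} \<phi>"
  then have s: "smooth_fun \<phi>" "smooth_fun (deriv \<phi>)"
    by (auto intro: smooth_fun_deriv test_function_smooth)
  have ends: "\<phi> p = 0" "\<phi> q = 0" "deriv \<phi> p = 0" "deriv \<phi> q = 0"
    using test_function_eq_0[OF \<phi>] test_function_eq_0[OF test_function_deriv[OF \<phi>]] by auto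
  obtain K L N where lip: "K-lipschitz_on {p..m} P" "L-lipschitz_on {m..q} Q" "N-lipschitz_on {p..q} R"
    using 1 2 F by (auto simp: C11_with_deriv_def)
  have contR: "continuous_on {p..q} R"
    using lip(3) by (rule lipschitz_on_continuous_on)
  \<comment> \<open>On the right piece the case distinction picks the left formula at the single
    point \<open>m\<close>, which is a null set.\<close>
  have spike: "integral {m..q} (\<lambda>x. (if x \<le> m then u x else v x) * w x) = integral {m..q} (\<lambda>x. v x * w x)"
    for u v w :: "real \<Rightarrow> real"
    by (rule integral_spike[of "{m}"]) auto
  have left: "integral {p..m} (\<lambda>x. (if x \<le> m then u x else v x) * w x) = integral {p..m} (\<lambda>x. u x * w x)"
    for u v w :: "real \<Rightarrow> real"
    by (rule integral_cong) simp
  have "integral {p..q} (\<lambda>x. R x * deriv \<phi> x) = integral {p..m} (\<lambda>x. R x * deriv \<phi> x) + integral {m..q} (\<lambda>x. R x * deriv \<phi> x)"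
    using assms(1,2) contR smooth_fun_continuous[OF s(2)]
    by (intro Henstock_Kurzweil_Integration.integral_combine[symmetric] integrable_continuous_interval
        continuous_intros) auto
  also have "\<dots> = integral {p..m} (\<lambda>x. P x * deriv \<phi> x) + integral {m..q} (\<lambda>x. Q x * deriv \<phi> x)"
    unfolding R_def spike left ..
  also have "integral {p..m} (\<lambda>x. P x * deriv \<phi> x) = P m * \<phi> m - integral {p..m} (\<lambda>x. g x * \<phi> x)"
    using weak_second_deriv_by_parts[OF \<open>p < m\<close> 1(2) _ lip(1) s(1)] 1(1) ends
    by (simp add: C11_with_deriv_def)
  also have "integral {m..q} (\<lambda>x. Q x * deriv \<phi> x) = - Q m * \<phi> m - integral {m..q} (\<lambda>x. h x * \<phi> x)"
    using weak_second_deriv_by_parts[OF \<open>m < q\<close> 2(2) _ lip(2) s(1)] 2(1) ends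
    by (simp add: C11_with_deriv_def)
  finally have "integral {p..q} (\<lambda>x. R x * deriv \<phi> x) =
      - (integral {p..m} (\<lambda>x. g x * \<phi> x) + integral {m..q} (\<lambda>x. h x * \<phi> x))"
    using eq by simp
  also have "integral {p..m} (\<lambda>x. g x * \<phi> x) + integral {m..q} (\<lambda>x. h x * \<phi> x) =
      integral {p..m} (\<lambda>x. ?g x * \<phi> x) + integral {m..q} (\<lambda>x. ?g x * \<phi> x)"
    unfolding spike left ..
  also have "\<dots> = integral {p..q} (\<lambda>x. ?g x * \<phi> x)"
    using assms(1,2) set_lebesgue_integral_eq_integral(1)[OF
        absolutely_integrable_bounded_times_continuous[OF meas bound smooth_fun_continuous[OF s(1)]]]
    by (intro Henstock_Kurzweil_Integration.integral_combine) auto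
  finally have "integral {p..q} (\<lambda>x. R x * deriv \<phi> x) = - integral {p..q} (\<lambda>x. ?g x * \<phi> x)" .
  \<comment> \<open>The classical integration by parts returns from first to second order. It runs
    over the whole interval, since \<open>?F\<close> has the continuous derivative \<open>R\<close>;
    this is where equality of the values at \<open>m\<close> enters.\<close>
  moreover have "integral {p..q} (\<lambda>x. ?F x * deriv (deriv \<phi>) x) =
      ?F q * deriv \<phi> q - ?F p * deriv \<phi> p - integral {p..q} (\<lambda>x. R x * deriv \<phi> x)"
    using assms(1,2) F smooth_fun_has_vector_derivative[OF s(2)] contR smooth_fun_continuous[OF smooth_fun_deriv[OF s(2)]]
    by (intro integral_by_parts_C1) (auto simp: C11_with_deriv_def)
  ultimately show "integral {p..q} (\<lambda>x. ?F x * deriv (deriv \<phi>) x) = integral {p..q} (\<lambda>x. ?g x * \<phi> x)"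
    using ends by simp
qed

text \<open>The common form of a competitor in either problem. \<open>M\<close> is an upper bound
  and not the norm itself, so neighbouring pieces can share it.\<close>

definition mono_C11_bounded :: "real \<Rightarrow> real \<Rightarrow> real \<Rightarrow> (real \<Rightarrow> real) \<Rightarrow> (real \<Rightarrow> real) \<Rightarrow> bool" where
  "mono_C11_bounded p q M F P \<longleftrightarrow> C11_with_deriv p q F P \<and> (\<forall>x\<in>{p..q}. 0 \<le> P x) \<and>
    (\<exists>g. weak_second_deriv p q M F g)"

lemma mono_C11_boundedI:
  assumes "p < q" "F \<in> C11 {p..q}" "\<forall>x\<in>{p..q}. 0 \<le> deriv_within {p..q} F x"
    and "norm_second_deriv {p..q} F < ereal M"
  shows "mono_C11_bounded p q M F (deriv_within {p..q} F)"
proof -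
  have F: "C11_with_deriv p q F (deriv_within {p..q} F)"
    using assms(1,2) C11_iff by blast
  show ?thesis
    using F assms(3) norm_second_deriv_lessE[OF C11_with_deriv_continuous[OF F] assms(1,4)]
    unfolding mono_C11_bounded_def by blast
qed

lemma mono_C11_boundedD:
  assumes "p < q" "mono_C11_bounded p q M F P"
  shows "F \<in> C11 {p..q}" "\<And>x. x \<in> {p..q} \<Longrightarrow> deriv_within {p..q} F x = P x"
    "\<And>x. x \<in> {p..q} \<Longrightarrow> 0 \<le> P x" "norm_second_deriv {p..q} F \<le> ereal M"
  using assms C11_with_deriv_imp_C11 C11_with_deriv_eq norm_second_deriv_le C11_with_deriv_continuous
  by (auto simp: mono_C11_bounded_def)

text \<open>Restriction and rescaling in one: the affine image of [p', q'] only has to lie in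
  [p, q]. With \<open>A = 1 / m\<close> slopes are unchanged and the bound is multiplied by
  \<open>m\<close>; both directions of the theorem use this case, with \<open>m\<close> the gap or
  its inverse.\<close>

lemma mono_C11_bounded_affine:
  assumes F: "mono_C11_bounded p q M F P"
    and "p' \<le> q'" "0 < m" "0 \<le> A" "p \<le> m * p' + c" "m * q' + c \<le> q"
  shows "mono_C11_bounded p' q' (A * m\<^sup>2 * M) (\<lambda>t. A * F (m * t + c) + B) (\<lambda>t. A * m * P (m * t + c))"
proof -
  have C: "C11_with_deriv p q F P" and pos: "\<And>x. x \<in> {p..q} \<Longrightarrow> 0 \<le> P x"
    using F by (auto simp: mono_C11_bounded_def)
  obtain g where "weak_second_deriv p q M F g"
    using F by (auto simp: mono_C11_bounded_def)
  then have "weak_second_deriv (m * p' + c) (m * q' + c) M F g"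
    using assms(5,6) by (rule weak_second_deriv_subinterval)
  moreover have "continuous_on {m * p' + c..m * q' + c} F"
    using assms(5,6) by (intro continuous_on_subset[OF C11_with_deriv_continuous[OF C]]) auto
  ultimately have "weak_second_deriv p' q' (A * m\<^sup>2 * M) (\<lambda>t. A * F (m * t + c) + B) (\<lambda>t. A * m\<^sup>2 * g (m * t + c))"
    using assms by (intro weak_second_deriv_affine)
  moreover have "0 \<le> A * m * P (m * t + c)" if "t \<in> {p'..q'}" for t
  proof -
    have "m * p' \<le> m * t" "m * t \<le> m * q'"
      using that \<open>0 < m\<close> by auto
    then have "m * t + c \<in> {p..q}"
      using assms(5,6) unfolding atLeastAtMost_iff by linarith
    then show ?thesis
      using pos assms(3,4) by simp
  qed
  ultimately show ?thesis
    using C11_with_deriv_affine[OF C assms(3,5,6)] by (auto simp: mono_C11_bounded_def)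
qed

lemma mono_C11_bounded_glue:
  assumes "p < m" "m < q" "mono_C11_bounded p m M F P" "mono_C11_bounded m q M G Q" "F m = G m" "P m = Q m"
  shows "mono_C11_bounded p q M (\<lambda>x. if x \<le> m then F x else G x) (\<lambda>x. if x \<le> m then P x else Q x)"
proof -
  obtain g h where "weak_second_deriv p m M F g" "weak_second_deriv m q M G h"
    using assms(3,4) by (auto simp: mono_C11_bounded_def)
  moreover have "C11_with_deriv p m F P" "C11_with_deriv m q G Q"
    using assms(3,4) by (simp_all add: mono_C11_bounded_def)
  ultimately have "\<exists>k. weak_second_deriv p q M (\<lambda>x. if x \<le> m then F x else G x) k"
    "C11_with_deriv p q (\<lambda>x. if x \<le> m then F x else G x) (\<lambda>x. if x \<le> m then P x else Q x)"
    using weak_second_deriv_glue[OF assms(1,2)] C11_with_deriv_glue[OF less_imp_le less_imp_le] assms by blast+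
  then show ?thesis
    using assms(3,4) by (auto simp: mono_C11_bounded_def)
qed

section \<open>Passing between the unit interval and the nodes\<close>

lemma M_star_less_imp_mono_C11_bounded:
  assumes "M_star a b c < ereal M"
  obtains G P where "mono_C11_bounded 0 1 M G P" "G 0 = 0" "G 1 = c" "P 0 = a" "P 1 = b"
proof -
  obtain G where "G \<in> C11 {0..1}" "G 0 = 0" "G 1 = c" "deriv_within {0..1} G 0 = a"
    "deriv_within {0..1} G 1 = b" "\<forall>x\<in>{0..1}. deriv_within {0..1} G x \<ge> 0"
    "norm_second_deriv {0..1} G < ereal M"
    using assms unfolding M_star_def INF_less_iff by auto
  then show ?thesis
    by (intro that[of G "deriv_within {0..1} G"] mono_C11_boundedI) auto
qed

lemma M_star_le:
  assumes G: "mono_C11_bounded 0 1 M G P" and "G 0 = 0" "G 1 = c"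
  shows "M_star (P 0) (P 1) c \<le> ereal M"
  unfolding M_star_def
  by (rule INF_lower2[of G]) (use mono_C11_boundedD[OF zero_less_one G] assms in auto)

lemma nodes_mono:
  fixes x :: "nat \<Rightarrow> real"
  assumes "\<forall>i<n. x i < x (Suc i)" "i \<le> j" "j \<le> n"
  shows "x i \<le> x j"
  using assms(2,3)
proof (induction j rule: dec_induct)
  case (step j)
  then have "x i \<le> x j" "x j < x (Suc j)"
    using assms(1) by simp_all
  then show ?case by linarith
qed simp

text \<open>The pieces are attached from left to right. Besides interpolation the induction keeps
  only the slope at the last node, which is all that the next piece has to match. It starts at 1
  because gluing needs nondegenerate intervals.\<close>

lemma mono_C11_bounded_interpolate:
  assumes "1 \<le> n" "\<forall>i<n. x i < x (Suc i)"
    and "\<And>i. i < n \<Longrightarrow> M_star (d i) (d (Suc i)) (slope x f i) < ereal (M * gap x i)"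
  shows "\<exists>F P. mono_C11_bounded (x 0) (x n) M F P \<and> (\<forall>i\<le>n. F (x i) = f (x i)) \<and> P (x n) = d n"
  using assms
proof (induction n rule: nat_induct_at_least)
  \<comment> \<open>The witness is h G((t - x_i) / h) + f(x_i): its slopes are those of
    \<open>G\<close>, and the bound \<open>M * h\<close> turns into h (1/h)^2 M h = M.\<close>
  have piece: "\<exists>F P. mono_C11_bounded (x i) (x (Suc i)) M F P \<and> F (x i) = f (x i) \<and>
      F (x (Suc i)) = f (x (Suc i)) \<and> P (x i) = d i \<and> P (x (Suc i)) = d (Suc i)"
    if less: "x i < x (Suc i)" and M: "M_star (d i) (d (Suc i)) (slope x f i) < ereal (M * gap x i)" for i
  proof -
    define h where "h = gap x i"
    have h: "0 < h" using less by (simp add: h_def gap_def)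
    obtain G P where G: "mono_C11_bounded 0 1 (M * h) G P" "G 0 = 0" "G 1 = slope x f i" "P 0 = d i" "P 1 = d (Suc i)"
      using M_star_less_imp_mono_C11_bounded[OF M] unfolding h_def by blast
    have "x (Suc i) = h + x i"
      by (simp add: h_def gap_def)
    then have u: "(1 / h) * x i + - x i / h = 0" "(1 / h) * x (Suc i) + - x i / h = 1"
      using h by (simp_all add: field_simps)
    have "mono_C11_bounded (x i) (x (Suc i)) (h * (1 / h)\<^sup>2 * (M * h))
        (\<lambda>t. h * G ((1 / h) * t + - x i / h) + f (x i)) (\<lambda>t. h * (1 / h) * P ((1 / h) * t + - x i / h))"
      by (rule mono_C11_bounded_affine[OF G(1)]) (use u h less in auto)
    moreover have "h * (1 / h)\<^sup>2 * (M * h) = M"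
      using h by (simp add: power2_eq_square)
    moreover have "h * slope x f i + f (x i) = f (x (Suc i))"
      using h by (simp add: slope_def h_def)
    ultimately show ?thesis
      using u G(2-) h
      by (intro exI[of _ "\<lambda>t. h * G ((1 / h) * t + - x i / h) + f (x i)"]
          exI[of _ "\<lambda>t. h * (1 / h) * P ((1 / h) * t + - x i / h)"]) simp
  qed
  {
    case base
    then show ?case
      using piece[of 0] by (auto simp: le_Suc_eq)
  next
    case (Suc n)
    obtain F P where F: "mono_C11_bounded (x 0) (x n) M F P" "\<forall>i\<le>n. F (x i) = f (x i)" "P (x n) = d n"
      using Suc by (meson less_SucI)
    obtain G Q where G: "mono_C11_bounded (x n) (x (Suc n)) M G Q" "G (x n) = f (x n)"
        "G (x (Suc n)) = f (x (Suc n))" "Q (x n) = d n" "Q (x (Suc n)) = d (Suc n)"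
      using piece[of n] Suc.prems by blast
    have xn: "x n < x (Suc n)" using Suc.prems by simp
    have "x 0 < x (Suc 0)" "x (Suc 0) \<le> x n"
      using Suc by (auto intro: nodes_mono[of n])
    then have "x 0 < x n" by linarith
    let ?F = "\<lambda>t. if t \<le> x n then F t else G t" and ?P = "\<lambda>t. if t \<le> x n then P t else Q t"
    have "mono_C11_bounded (x 0) (x (Suc n)) M ?F ?P"
      using \<open>x 0 < x n\<close> xn F G by (intro mono_C11_bounded_glue) auto
    moreover have "?F (x i) = f (x i)" if "i \<le> Suc n" for i
    proof (cases "i = Suc n")
      case True
      then show ?thesis using xn G(3) by simp
    next
      case False
      then have "i \<le> n" using that by simp
      then have "x i \<le> x n" using Suc.prems by (intro nodes_mono[of "Suc n"]) auto
      then show ?thesis using F(2) \<open>i \<le> n\<close> by simp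
    qed
    moreover have "?P (x (Suc n)) = d (Suc n)"
      using xn G(5) by simp
    ultimately show ?case by blast
  }
qed

text \<open>The reals are dense in \<open>ereal\<close>. The strict premise is what lets a
  competitor be drawn from an infimum, and an infinite \<open>b\<close> makes the assumption vacuous
  and the conclusion trivial.\<close>

lemma ereal_le_if_all_greater_reals:
  fixes a b :: ereal
  assumes "\<And>M. b < ereal M \<Longrightarrow> a \<le> ereal M"
  shows "a \<le> b"
proof (rule dense_ge)
  fix z assume "b < z"
  then obtain M where "b < ereal M" "ereal M < z"
    using ereal_dense2 by blast
  then show "a \<le> z"
    using assms by (meson less_imp_le order.trans)
qed

theorem theorem2p3:
  fixes N :: nat and x :: "nat \<Rightarrow> real" and f :: "real \<Rightarrow> real"
  assumes "N \<ge> 1"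
    and "\<forall>i<N. x i < x (Suc i)"
    and "\<forall>i<N. f (x i) \<le> f (x (Suc i))"
  shows "mon_trace_seminorm {x 0..x N} (x ` {0..N}) f = N_mon N x f"
proof (rule antisym)
  have "x 0 < x (Suc 0)" "x (Suc 0) \<le> x N"
    using assms(1,2) by (auto intro: nodes_mono[of N])
  then have x0N: "x 0 < x N" by linarith
  have gap: "0 < gap x i" if "i < N" for i
    using assms(2) that by (simp add: gap_def)
  \<comment> \<open>Subtraction on \<open>nat\<close> is truncated; \<open>N \<ge> 1\<close> ensures
    that the set under the maximum consists exactly of the pieces.\<close>
  have idx: "i \<in> {0..N - 1} \<longleftrightarrow> i < N" for i
    using assms(1) by auto
  show "mon_trace_seminorm {x 0..x N} (x ` {0..N}) f \<le> N_mon N x f"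
  proof (rule ereal_le_if_all_greater_reals)
    fix M assume "N_mon N x f < ereal M"
    then obtain d where "N_mon_at N x f d < ereal M"
      unfolding N_mon_def INF_less_iff by blast
    then have quot: "M_star (d i) (d (Suc i)) (slope x f i) / ereal (gap x i) < ereal M" if "i < N" for i
      using that idx unfolding N_mon_at_def by (subst (asm) Max_less_iff) auto
    have "M_star (d i) (d (Suc i)) (slope x f i) < ereal (M * gap x i)" if "i < N" for i
      using quot[OF that] gap[OF that] by (simp add: ereal_divide_less_iff mult.commute)
    from mono_C11_bounded_interpolate[OF assms(1,2) this]
    obtain F P where F: "mono_C11_bounded (x 0) (x N) M F P" "\<forall>i\<le>N. F (x i) = f (x i)"
      by blast
    show "mon_trace_seminorm {x 0..x N} (x ` {0..N}) f \<le> ereal M"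
      unfolding mon_trace_seminorm_def
      by (rule INF_lower2[of F]) (use mono_C11_boundedD[OF x0N F(1)] F(2) in auto)
  qed
  show "N_mon N x f \<le> mon_trace_seminorm {x 0..x N} (x ` {0..N}) f"
  proof (rule ereal_le_if_all_greater_reals)
    fix M assume "mon_trace_seminorm {x 0..x N} (x ` {0..N}) f < ereal M"
    then obtain F where F: "F \<in> C11 {x 0..x N}" "\<forall>y\<in>x ` {0..N}. F y = f y"
      "\<forall>y\<in>{x 0..x N}. 0 \<le> deriv_within {x 0..x N} F y" "norm_second_deriv {x 0..x N} F < ereal M"
      unfolding mon_trace_seminorm_def INF_less_iff by auto
    define P where "P = deriv_within {x 0..x N} F"
    have FP: "mono_C11_bounded (x 0) (x N) M F P"
      unfolding P_def by (rule mono_C11_boundedI[OF x0N F(1,3,4)])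
    have "M_star (P (x i)) (P (x (Suc i))) (slope x f i) / ereal (gap x i) \<le> ereal M" if i: "i < N" for i
    proof -
      define h where "h = gap x i"
      have h: "0 < h" using gap[OF i] by (simp add: h_def)
      \<comment> \<open>Dividing by \<open>h\<close> keeps the slopes and makes the increment of
        \<open>G\<close> over the unit interval equal to \<open>slope x f i\<close>; the bound
        becomes (1/h) h^2 M = h M.\<close>
      define G where "G t = (1 / h) * F (h * t + x i) + - F (x i) / h" for t
      have x1: "h + x i = x (Suc i)"
        by (simp add: h_def gap_def)
      have "x 0 \<le> x i" "x (Suc i) \<le> x N"
        using i by (auto intro: nodes_mono[OF assms(2)])
      then have "mono_C11_bounded 0 1 ((1 / h) * h\<^sup>2 * M) G (\<lambda>t. (1 / h) * h * P (h * t + x i))"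
        unfolding G_def[abs_def] by (intro mono_C11_bounded_affine[OF FP]) (use h x1 in auto)
      then have "mono_C11_bounded 0 1 (h * M) G (\<lambda>t. P (h * t + x i))"
        using h by (simp add: power2_eq_square)
      moreover have "G 0 = 0" by (simp add: G_def)
      moreover have "G 1 = slope x f i"
        using F(2) i h x1 by (simp add: G_def slope_def h_def[symmetric] diff_divide_distrib)
      ultimately have "M_star (P (x i)) (P (x (Suc i))) (slope x f i) \<le> ereal (h * M)"
        using M_star_le[of "h * M" G "\<lambda>t. P (h * t + x i)"] by (simp add: x1)
      then show ?thesis
        using h by (simp add: ereal_divide_le_pos h_def)
    qed
    then have "N_mon_at N x f (\<lambda>i. P (x i)) \<le> ereal M"
      using idx unfolding N_mon_at_def by (subst Max_le_iff) auto
    moreover have "\<forall>i\<le>N. 0 \<le> P (x i)"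
      using mono_C11_boundedD(3)[OF x0N FP] nodes_mono[OF assms(2)] by auto
    ultimately show "N_mon N x f \<le> ereal M"
      unfolding N_mon_def by (intro INF_lower2[of "\<lambda>i. P (x i)"]) auto
  qed
qed

end
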